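(* Let $F$ be a pre-Finsler metric on a connected manifold $S$ and let $d_F:S\times S\to\mathbb{R}\cup\{-\infty\}$ be its associated pre-distance. Then: (i) $d_F$ satisfies the triangle inequality $d_F(x,z)\le d_F(x,y)+d_F(y,z)$ for all $x,y,z\in S$ (with the usual convention about sums with $-\infty$); (ii) if $\gamma:[a,b]\to S$ is a piecewise smooth curve with $d_F(\gamma(a),\gamma(b))=\ell_F(\gamma)$, then $\gamma$ is a pregeodesic of $F$; (iii) if $d_F(x,x)<0$ for some $x\in S$, then $d_F\equiv-\infty$; (iv) if $d_F(x,y)=-\infty$ for some $x,y\in S$, then $d_F\equiv-\infty$; (v) if $d_F\not\equiv-\infty$, then $d_F:S\times S\to\mathbb{R}$ is continuous.
   Context: A pre-Finsler metric on a smooth manifold $S$ is a function $F:TS\to\mathbb{R}$ that is smooth on $TS$ minus the zero section and positively homogeneous: $F(\lambda v)=\lambda F(v)$ for all $v\in TS$, $\lambda>0$ (so $F(0)=0$; $F$ may take negative values). The length of a piecewise smooth curve $c:[t_0,t_1]\to S$ is $\ell_F(c)=\int_{t_0}^{t_1}F(\dot c(s))\,ds$. $C(x_0,x_1)$ is the set of piecewise smooth curves from $x_0$ to $x_1$ (constant curves allowed). The pre-distance is $d_F(x_0,x_1)=\inf_{c\in C(x_0,x_1)}\ell_F(c)\in\mathbb{R}\cup\{-\infty\}$. A curve from $x_0$ to $x_1$ is a pregeodesic of $F$ if it is a critical point of $\ell_F$ in $C(x_0,x_1)$ (i.e. under variations with fixed endpoints). *)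

theory Defs
  imports "HOL-Analysis.Analysis"
begin

section \<open>Smooth maps between Euclidean spaces\<close>

text \<open>
  For open \<open>S\<close> in a Euclidean space: \<open>C_on n S f\<close> says that \<open>f\<close> is of class \<open>C^n\<close>
  on \<open>S\<close>.  Asking for a total derivative whose evaluations in all fixed directions \<open>v\<close>
  are \<open>C^n\<close> is the usual \<open>C^(n+1)\<close> condition, since the domain is finite-dimensional.
\<close>

primrec C_on ::
  "nat \<Rightarrow> 'p::euclidean_space set \<Rightarrow> ('p \<Rightarrow> 'q::real_normed_vector) \<Rightarrow> bool" where
  "C_on 0 S f \<longleftrightarrow> continuous_on S f"
| "C_on (Suc n) S f \<longleftrightarrow>
     (\<forall>x\<in>S. f differentiable (at x)) \<and> (\<forall>v. C_on n S (\<lambda>x. frechet_derivative f (at x) v))"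

definition smooth_on :: "'p::euclidean_space set \<Rightarrow> ('p \<Rightarrow> 'q::real_normed_vector) \<Rightarrow> bool" where
  "smooth_on S f \<longleftrightarrow> (\<forall>n. C_on n S f)"

section \<open>Smooth manifolds\<close>

text \<open>
  A manifold is a topology \<open>T\<close> on the set \<open>topspace T\<close> together with a (not necessarily
  maximal) smooth atlas \<open>A\<close>.  A chart is a pair \<open>(U, \<phi>)\<close>; the values of \<open>\<phi>\<close> outside \<open>U\<close>
  are irrelevant.
\<close>

type_synonym ('a, 'e) chart = "'a set \<times> ('a \<Rightarrow> 'e)"

definition transition :: "('a, 'e) chart \<Rightarrow> ('a, 'e) chart \<Rightarrow> 'e \<Rightarrow> 'e" where
  "transition c d = snd d \<circ> inv_into (fst c) (snd c)"

definition smooth_manifold :: "'a topology \<Rightarrow> ('a, 'e::euclidean_space) chart set \<Rightarrow> bool" where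
  "smooth_manifold T A \<longleftrightarrow>
     Hausdorff_space T \<and> second_countable T \<and>
     (\<Union>(U, \<phi>)\<in>A. U) = topspace T \<and>
     (\<forall>(U, \<phi>)\<in>A. openin T U \<and> open (\<phi> ` U) \<and>
        homeomorphic_map (subtopology T U) (top_of_set (\<phi> ` U)) \<phi>) \<and>
     (\<forall>c\<in>A. \<forall>d\<in>A. smooth_on (snd c ` (fst c \<inter> fst d)) (transition c d))"

text \<open>
  Smoothness of a map into the manifold from an arbitrary subset \<open>X\<close> of a Euclidean space:
  near every point of \<open>X\<close> the map is, in a chart, the restriction of a smooth map defined
  on an open set.
\<close>

definition smooth_into ::
  "('a, 'e::euclidean_space) chart set \<Rightarrow> 'p::euclidean_space set \<Rightarrow> ('p \<Rightarrow> 'a) \<Rightarrow> bool" where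
  "smooth_into A X f \<longleftrightarrow>
     (\<forall>p\<in>X. \<exists>(U, \<phi>)\<in>A. \<exists>W g. open W \<and> p \<in> W \<and> f ` (W \<inter> X) \<subseteq> U \<and>
        smooth_on W g \<and> (\<forall>q\<in>W \<inter> X. g q = \<phi> (f q)))"

section \<open>Tangent vectors and pre-Finsler metrics\<close>

text \<open>
  A tangent vector at \<open>p\<close> is given by its components in all charts around \<open>p\<close>, subject to
  the transformation rule; the component at an index which is not a chart around \<open>p\<close> is
  fixed to be \<open>0\<close>.  The tangent bundle is the set of pairs \<open>(p, v)\<close> with
  \<open>v \<in> tangent_space A p\<close>.
\<close>

type_synonym ('a, 'e) tvec = "('a, 'e) chart \<Rightarrow> 'e"

definition tangent_space ::
  "('a, 'e::euclidean_space) chart set \<Rightarrow> 'a \<Rightarrow> ('a, 'e) tvec set" where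
  "tangent_space A p =
     {v. (\<forall>c. c \<notin> A \<or> p \<notin> fst c \<longrightarrow> v c = 0) \<and>
         (\<forall>c\<in>A. \<forall>d\<in>A. p \<in> fst c \<inter> fst d \<longrightarrow>
            v d = frechet_derivative (transition c d) (at (snd c p)) (v c))}"

text \<open>The tangent vector at \<open>p\<close> whose component in the chart \<open>c\<close> is \<open>w\<close>.\<close>

definition tangent_of ::
  "('a, 'e::euclidean_space) chart set \<Rightarrow> ('a, 'e) chart \<Rightarrow> 'a \<Rightarrow> 'e \<Rightarrow> ('a, 'e) tvec" where
  "tangent_of A c p w =
     (\<lambda>d. if d \<in> A \<and> p \<in> fst d then frechet_derivative (transition c d) (at (snd c p)) w else 0)"

text \<open>
  A function \<open>F\<close> on the tangent bundle is curried, \<open>F p v\<close>.  Smoothness away from the zero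
  section is smoothness in the bundle charts \<open>(p, v) \<mapsto> (\<phi> p, v (U, \<phi>))\<close>.
\<close>

definition pre_finsler ::
  "('a, 'e::euclidean_space) chart set \<Rightarrow> ('a \<Rightarrow> ('a, 'e) tvec \<Rightarrow> real) \<Rightarrow> bool" where
  "pre_finsler A F \<longleftrightarrow>
     (\<forall>(U, \<phi>)\<in>A. smooth_on (\<phi> ` U \<times> (UNIV - {0}))
        (\<lambda>(x, w). let p = inv_into U \<phi> x in F p (tangent_of A (U, \<phi>) p w))) \<and>
     (\<forall>(U, \<phi>)\<in>A. \<forall>p\<in>U. \<forall>v\<in>tangent_space A p. \<forall>r>0.
        F p (\<lambda>c. r *\<^sub>R v c) = r * F p v)"

section \<open>Curves, length and pre-distance\<close>

definition subdivision :: "real \<Rightarrow> real \<Rightarrow> nat \<Rightarrow> (nat \<Rightarrow> real) \<Rightarrow> bool" where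
  "subdivision a b n t \<longleftrightarrow> t 0 = a \<and> t n = b \<and> (\<forall>i<n. t i < t (Suc i))"

text \<open>
  Smoothness is required on the closed subintervals, which includes their common end points;
  in particular such a curve is continuous.
\<close>

definition piecewise_smooth ::
  "('a, 'e::euclidean_space) chart set \<Rightarrow> (real \<Rightarrow> 'a) \<Rightarrow> real \<Rightarrow> real \<Rightarrow> bool" where
  "piecewise_smooth A \<gamma> a b \<longleftrightarrow> a < b \<and>
     (\<exists>n t. subdivision a b n t \<and> (\<forall>i<n. smooth_into A {t i..t (Suc i)} \<gamma>))"

text \<open>The velocity at \<open>u\<close>, computed within \<open>X\<close> (hence one-sided at the end points of an interval).\<close>

definition velocity ::
  "('a, 'e::euclidean_space) chart set \<Rightarrow> real set \<Rightarrow> (real \<Rightarrow> 'a) \<Rightarrow> real \<Rightarrow> ('a, 'e) tvec" where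
  "velocity A X \<gamma> u =
     (\<lambda>c. if c \<in> A \<and> \<gamma> u \<in> fst c then vector_derivative (snd c \<circ> \<gamma>) (at u within X) else 0)"

text \<open>
  At the finitely many break points of a piecewise smooth curve the velocity in the integrand
  is unspecified; this does not affect the integral.
\<close>

definition len ::
  "('a, 'e::euclidean_space) chart set \<Rightarrow> ('a \<Rightarrow> ('a, 'e) tvec \<Rightarrow> real) \<Rightarrow>
   (real \<Rightarrow> 'a) \<Rightarrow> real \<Rightarrow> real \<Rightarrow> real" where
  "len A F \<gamma> a b = integral {a..b} (\<lambda>u. F (\<gamma> u) (velocity A {a..b} \<gamma> u))"

definition curves ::
  "('a, 'e::euclidean_space) chart set \<Rightarrow> 'a \<Rightarrow> 'a \<Rightarrow> ((real \<Rightarrow> 'a) \<times> real \<times> real) set" where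
  "curves A x y = {(\<gamma>, a, b). piecewise_smooth A \<gamma> a b \<and> \<gamma> a = x \<and> \<gamma> b = y}"

definition pre_dist ::
  "('a, 'e::euclidean_space) chart set \<Rightarrow> ('a \<Rightarrow> ('a, 'e) tvec \<Rightarrow> real) \<Rightarrow> 'a \<Rightarrow> 'a \<Rightarrow> ereal" where
  "pre_dist A F x y = (INF (\<gamma>, a, b)\<in>curves A x y. ereal (len A F \<gamma> a b))"

section \<open>Pregeodesics\<close>

text \<open>Piecewise smooth variations \<open>H s\<close>, \<open>\<bar>s\<bar> < \<epsilon>\<close>, of \<open>\<gamma> = H 0\<close> with fixed end points.\<close>

definition variation ::
  "('a, 'e::euclidean_space) chart set \<Rightarrow> (real \<Rightarrow> 'a) \<Rightarrow> real \<Rightarrow> real \<Rightarrow> real \<Rightarrow>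
   (real \<Rightarrow> real \<Rightarrow> 'a) \<Rightarrow> bool" where
  "variation A \<gamma> a b \<epsilon> H \<longleftrightarrow> 0 < \<epsilon> \<and>
     (\<forall>u\<in>{a..b}. H 0 u = \<gamma> u) \<and>
     (\<forall>s\<in>{-\<epsilon><..<\<epsilon>}. H s a = \<gamma> a \<and> H s b = \<gamma> b) \<and>
     (\<exists>n t. subdivision a b n t \<and>
        (\<forall>i<n. smooth_into A ({-\<epsilon><..<\<epsilon>} \<times> {t i..t (Suc i)}) (\<lambda>(s, u). H s u)))"

definition regular_curve ::
  "('a, 'e::euclidean_space) chart set \<Rightarrow> (real \<Rightarrow> 'a) \<Rightarrow> real \<Rightarrow> real \<Rightarrow> bool" where
  "regular_curve A \<gamma> a b \<longleftrightarrow> a < b \<and>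
     (\<exists>n t. subdivision a b n t \<and>
        (\<forall>i<n. smooth_into A {t i..t (Suc i)} \<gamma> \<and>
           (\<forall>u\<in>{t i..t (Suc i)}. velocity A {t i..t (Suc i)} \<gamma> u \<noteq> (\<lambda>_. 0))))"

text \<open>
  Critical points of the length among curves with fixed end points.  For a curve whose
  (one-sided) velocities never vanish, the derivative of the length along every variation has
  to exist and to be \<open>0\<close>.  As \<open>F\<close> need not be differentiable on the zero section, the length
  need not be differentiable at other curves (for instance, at a constant curve when \<open>F\<close> is
  the norm of a Riemannian metric); there, the derivative has to be \<open>0\<close> along every variation
  along which it exists.
\<close>

definition pregeodesic ::
  "('a, 'e::euclidean_space) chart set \<Rightarrow> ('a \<Rightarrow> ('a, 'e) tvec \<Rightarrow> real) \<Rightarrow>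
   (real \<Rightarrow> 'a) \<Rightarrow> real \<Rightarrow> real \<Rightarrow> bool" where
  "pregeodesic A F \<gamma> a b \<longleftrightarrow> piecewise_smooth A \<gamma> a b \<and>
     (\<forall>\<epsilon> H. variation A \<gamma> a b \<epsilon> H \<longrightarrow>
        (regular_curve A \<gamma> a b \<longrightarrow> ((\<lambda>s. len A F (H s) a b) has_real_derivative 0) (at 0)) \<and>
        (\<forall>D. ((\<lambda>s. len A F (H s) a b) has_real_derivative D) (at 0) \<longrightarrow> D = 0))"

end

theory Submission
  imports Defs
begin

text \<open>
  Everything that concerns distances follows from two facts.  Concatenation of curves is additive
  for the length, which gives the triangle inequality (\<open>pre_dist_triangle\<close>).  And nearby points are
  joined in both directions by curves of length less than any given \<open>e > 0\<close> (\<open>pre_dist_small\<close>):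
  in a chart, homogeneity bounds \<open>F\<close> by a multiple of the Euclidean norm, locally uniformly in the
  base point (\<open>local_F_bound\<close>), so that a coordinate segment costs at most a multiple of its
  Euclidean length.

  On a connected manifold the second fact makes the set of points that can be reached from a given
  one open and closed, so that the pre-distance is never \<open>\<infinity>\<close>.  A value \<open>-\<infinity>\<close> anywhere then spreads
  everywhere by the triangle inequality, and \<open>d x x < 0\<close> forces \<open>d x x = -\<infinity>\<close> because
  \<open>d x x \<le> d x x + d x x\<close>: one may run through a loop of negative length as often as one likes.  If all
  values are finite, the triangle inequality bounds the variation of \<open>d\<close> near a pair of points by
  the small distances to these points, whence continuity.

  A minimizing curve \<open>\<gamma>\<close> is critical for the usual reason: along a variation \<open>H\<close> with fixed end
  points the length is at least the pre-distance, hence minimal at \<open>H 0 = \<gamma>\<close>, and its derivative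
  vanishes if it exists.  The analytic content is that it does exist when the
  velocity of \<open>\<gamma>\<close> has no zero (\<open>regular_variation_differentiable\<close>).  By compactness the velocities
  of the curves \<open>H s\<close> then stay away from the zero section, where \<open>F\<close> is possibly not smooth, for all
  small \<open>s\<close>.  So on each smooth piece the integrand is continuously differentiable in \<open>s\<close>, and the
  derivative may be taken under the integral sign.
\<close>

section \<open>Calculus of smooth maps\<close>

lemma C_on_SucD:
  assumes "C_on (Suc n) S f" "x \<in> S"
  shows "(f has_derivative frechet_derivative f (at x)) (at x)"
proof -
  have "f differentiable (at x)" using assms by simp
  then show ?thesis using frechet_derivative_works by blast
qed

lemma smooth_on_has_derivative:
  assumes "smooth_on S f" "x \<in> S"
  shows "(f has_derivative frechet_derivative f (at x)) (at x)"
proof -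
  have "C_on (Suc 0) S f" using assms(1) unfolding smooth_on_def by blast
  then show ?thesis using C_on_SucD assms(2) by blast
qed

lemma smooth_on_C_on: "smooth_on S f \<Longrightarrow> C_on n S f"
  by (simp add: smooth_on_def)

lemma smooth_on_imp_continuous_on: "smooth_on S f \<Longrightarrow> continuous_on S f"
  using smooth_on_C_on[of S f 0] by simp

lemma smooth_on_frechet_derivative:
  assumes "smooth_on S f"
  shows "smooth_on S (\<lambda>x. frechet_derivative f (at x) v)"
proof -
  have "C_on n S (\<lambda>x. frechet_derivative f (at x) v)" for n
  proof -
    have "C_on (Suc n) S f" using assms by (rule smooth_on_C_on)
    then show ?thesis by simp
  qed
  then show ?thesis unfolding smooth_on_def by (rule allI)
qed

text \<open>
  The recursion passes through derivatives at points of \<open>S\<close>, which see values only near those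
  points; hence openness of \<open>S\<close>.
\<close>

lemma C_on_cong:
  assumes "open S" "\<And>x. x \<in> S \<Longrightarrow> f x = g x" "C_on n S f"
  shows "C_on n S g"
  using assms(2,3)
proof (induction n arbitrary: f g)
  case 0
  then show ?case by (metis C_on.simps(1) continuous_on_cong)
next
  case (Suc n)
  have D: "(g has_derivative frechet_derivative f (at x)) (at x)" if "x \<in> S" for x
    by (rule has_derivative_transform_within_open[OF C_on_SucD[OF Suc.prems(2) that] assms(1) that])
      (rule Suc.prems(1))
  have eq: "frechet_derivative f (at x) = frechet_derivative g (at x)" if "x \<in> S" for x
    by (rule frechet_derivative_at[OF D[OF that]])
  have "C_on n S (\<lambda>x. frechet_derivative g (at x) v)" for v
    by (rule Suc.IH[where f="\<lambda>x. frechet_derivative f (at x) v"]) (use eq Suc.prems in auto)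
  then show ?case using D by (auto simp: differentiable_def)
qed

text \<open>
  The two uses are translation, for reparametrizing curves, and restriction to a line parallel to
  an axis, for passing from a variation to a single curve.  Such inner maps have constant
  derivative, so that no higher-order chain rule arises.
\<close>

lemma C_on_compose_affine:
  fixes L :: "'p::euclidean_space \<Rightarrow> 'q::euclidean_space"
  assumes L: "bounded_linear L" and op: "open S" and f: "C_on n S f"
  shows "C_on n ((\<lambda>x. a + L x) -` S) (\<lambda>x. f (a + L x))"
  using f
proof (induction n arbitrary: f)
  case 0
  have "continuous_on ((\<lambda>x. a + L x) -` S) (\<lambda>x. a + L x)"
    by (intro continuous_intros linear_continuous_on L)
  then show ?case
    using 0 continuous_on_compose2[of S f "(\<lambda>x. a + L x) -` S" "\<lambda>x. a + L x"] by auto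
next
  case (Suc n)
  let ?S = "(\<lambda>x. a + L x) -` S"
  have cont: "continuous_on UNIV (\<lambda>x. a + L x)"
    by (intro continuous_intros linear_continuous_on L)
  have opS: "open ?S" using op cont by (simp add: open_vimage)
  have D: "((\<lambda>x. f (a + L x)) has_derivative (\<lambda>v. frechet_derivative f (at (a + L x)) (L v))) (at x)"
    if "x \<in> ?S" for x
  proof -
    have "((\<lambda>x. a + L x) has_derivative L) (at x)"
      using bounded_linear_imp_has_derivative[OF L, of "at x"] by (auto intro!: derivative_eq_intros)
    moreover have "(f has_derivative frechet_derivative f (at (a + L x))) (at (a + L x))"
      using that C_on_SucD[OF Suc.prems] by auto
    ultimately show ?thesis
      using has_derivative_compose by blast
  qed
  have "C_on n ?S (\<lambda>x. frechet_derivative (\<lambda>x. f (a + L x)) (at x) v)" for v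
  proof (rule C_on_cong[OF opS])
    show "C_on n ?S (\<lambda>x. frechet_derivative f (at (a + L x)) (L v))"
      using Suc.IH[of "\<lambda>y. frechet_derivative f (at y) (L v)"] Suc.prems by auto
  qed (use frechet_derivative_at[OF D] in metis)
  then show ?case using D by (auto simp: differentiable_def)
qed

lemma smooth_on_compose_affine:
  fixes L :: "'p::euclidean_space \<Rightarrow> 'q::euclidean_space"
  assumes "bounded_linear L" "open S" "smooth_on S f"
  shows "smooth_on ((\<lambda>x. a + L x) -` S) (\<lambda>x. f (a + L x))"
  using assms C_on_compose_affine unfolding smooth_on_def by blast

lemma C_on_const: "C_on n S (\<lambda>_. c)"
  by (induction n arbitrary: c) auto

lemma smooth_on_affine:
  fixes L :: "'p::euclidean_space \<Rightarrow> 'q::real_normed_vector"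
  assumes L: "bounded_linear L"
  shows "smooth_on S (\<lambda>x. a + L x)"
proof -
  have D: "((\<lambda>x. a + L x) has_derivative L) (at x)" for x
    using bounded_linear_imp_has_derivative[OF L, of "at x"] by (auto intro!: derivative_eq_intros)
  have "C_on n S (\<lambda>x. a + L x)" for n
  proof (cases n)
    case 0
    have "continuous_on S (\<lambda>x. a + L x)" by (intro continuous_intros linear_continuous_on L)
    with 0 show ?thesis by simp
  next
    case (Suc m)
    then show ?thesis
      using D by (auto simp: differentiable_def C_on_const simp flip: frechet_derivative_at[OF D])
  qed
  then show ?thesis by (simp add: smooth_on_def)
qed

text \<open>
  The definition of smoothness only controls the derivative in each fixed direction; writing
  the direction in a finite basis makes it jointly continuous in point and direction.
\<close>

lemma continuous_on_frechet_derivative: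
  fixes f :: "'p::euclidean_space \<Rightarrow> 'q::real_normed_vector"
  assumes f: "smooth_on S f" and x: "continuous_on X x" "x ` X \<subseteq> S" and v: "continuous_on X v"
  shows "continuous_on X (\<lambda>z. frechet_derivative f (at (x z)) (v z))"
proof -
  have eq: "frechet_derivative f (at (x z)) (v z)
      = (\<Sum>b\<in>Basis. (v z \<bullet> b) *\<^sub>R frechet_derivative f (at (x z)) b)" if "z \<in> X" for z
  proof -
    have "bounded_linear (frechet_derivative f (at (x z)))"
      using smooth_on_has_derivative[OF f] x that has_derivative_bounded_linear by blast
    then interpret bounded_linear "frechet_derivative f (at (x z))" .
    have "frechet_derivative f (at (x z)) (\<Sum>b\<in>Basis. (v z \<bullet> b) *\<^sub>R b)
      = (\<Sum>b\<in>Basis. (v z \<bullet> b) *\<^sub>R frechet_derivative f (at (x z)) b)"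
      by (simp add: sum scaleR)
    then show ?thesis by (simp add: euclidean_representation)
  qed
  have "continuous_on X (\<lambda>z. frechet_derivative f (at (x z)) b)" for b
    using continuous_on_compose2[OF smooth_on_imp_continuous_on[OF smooth_on_frechet_derivative[OF f]] x] .
  then have "continuous_on X (\<lambda>z. \<Sum>b\<in>Basis. (v z \<bullet> b) *\<^sub>R frechet_derivative f (at (x z)) b)"
    by (intro continuous_intros v)
  then show ?thesis using eq by (simp cong: continuous_on_cong)
qed

lemma smooth_on_curve_has_vector_derivative:
  fixes g :: "real \<Rightarrow> 'q::real_normed_vector"
  assumes "smooth_on W g" "u \<in> W"
  shows "(g has_vector_derivative frechet_derivative g (at u) 1) (at u within X)"
proof -
  have D: "(g has_derivative frechet_derivative g (at u)) (at u)"
    using smooth_on_has_derivative assms by blast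
  then interpret bounded_linear "frechet_derivative g (at u)" by (rule has_derivative_bounded_linear)
  have "frechet_derivative g (at u) = (\<lambda>h. h *\<^sub>R frechet_derivative g (at u) 1)"
    by (metis mult.right_neutral real_scaleR_def scaleR)
  with D show ?thesis unfolding has_vector_derivative_def by (metis has_derivative_at_withinI)
qed

lemma smooth_on_partial_fst:
  fixes f :: "real \<times> real \<Rightarrow> 'q::real_normed_vector"
  assumes "smooth_on W f" "(s, u) \<in> W"
  shows "((\<lambda>s. f (s, u)) has_vector_derivative frechet_derivative f (at (s, u)) (1, 0)) (at s within X)"
proof -
  have "((\<lambda>s. (s, u)) has_vector_derivative (1, 0)) (at s within X)"
    by (auto intro!: derivative_eq_intros)
  from vector_derivative_diff_chain_within[OF this has_derivative_at_withinI[OF smooth_on_has_derivative[OF assms]]]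
  show ?thesis by (simp add: o_def)
qed

lemma smooth_on_partial_snd:
  fixes f :: "real \<times> real \<Rightarrow> 'q::real_normed_vector"
  assumes "smooth_on W f" "(s, u) \<in> W"
  shows "((\<lambda>u. f (s, u)) has_vector_derivative frechet_derivative f (at (s, u)) (0, 1)) (at u within X)"
proof -
  have "((\<lambda>u. (s, u)) has_vector_derivative (0, 1)) (at u within X)"
    by (auto intro!: derivative_eq_intros)
  from vector_derivative_diff_chain_within[OF this has_derivative_at_withinI[OF smooth_on_has_derivative[OF assms]]]
  show ?thesis by (simp add: o_def)
qed

lemma continuous_on_local:
  fixes f :: "'b::t2_space \<Rightarrow> 'c::topological_space"
  assumes "\<And>x. x \<in> X \<Longrightarrow> \<exists>W. open W \<and> x \<in> W \<and> continuous_on (W \<inter> X) f"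
  shows "continuous_on X f"
  unfolding continuous_on_eq_continuous_within
proof
  fix x assume "x \<in> X"
  then obtain W where W: "open W" "x \<in> W" "continuous_on (W \<inter> X) f" using assms by blast
  then have "continuous (at x within W \<inter> X) f"
    using \<open>x \<in> X\<close> by (simp add: continuous_on_eq_continuous_within)
  moreover have "at x within W \<inter> X = at x within X"
    using W by (intro at_within_nhd[of x W]) auto
  ultimately show "continuous (at x within X) f" by simp
qed

lemma has_vector_derivative_shift:
  fixes f :: "real \<Rightarrow> 'b::real_normed_vector"
  assumes "(f has_vector_derivative w) (at (h + u) within {a..b})"
  shows "((\<lambda>u. f (h + u)) has_vector_derivative w) (at u within {a - h..b - h})"
proof -
  have "((+) h has_vector_derivative 1) (at u within {a - h..b - h})"
    by (auto intro!: derivative_eq_intros)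
  moreover have "(+) h ` {a - h..b - h} = {a..b}" by simp
  ultimately show ?thesis
    using vector_diff_chain_within[of "(+) h" 1 u "{a - h..b - h}" f w] assms by (simp add: o_def)
qed

section \<open>Subdivisions\<close>

lemma subdivision_mono:
  assumes "subdivision a b n t" "i \<le> j" "j \<le> n" shows "t i \<le> t j"
  using assms(2,3)
proof (induction j rule: dec_induct)
  case (step j)
  then show ?case using assms(1) unfolding subdivision_def by (smt (verit) Suc_leD Suc_le_lessD)
qed simp

lemma subdivision_subset:
  assumes "subdivision a b n t" "i < n" shows "{t i..t (Suc i)} \<subseteq> {a..b}"
proof -
  have "a \<le> t i" "t (Suc i) \<le> b"
    using subdivision_mono[OF assms(1), of 0 i] subdivision_mono[OF assms(1), of "Suc i" n] assms
    by (auto simp: subdivision_def)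
  then show ?thesis by auto
qed

text \<open>
  This and the following lemma choose the piece of a subdivision on which the right,
  respectively left, derivative at a point is to be taken.
\<close>

lemma subdivision_covers_right:
  assumes "subdivision a b n t" "a \<le> u" "u < b"
  shows "\<exists>j<n. t j \<le> u \<and> u < t (Suc j)"
  using assms
proof (induction n arbitrary: b)
  case (Suc n)
  show ?case
  proof (cases "u < t n")
    case True
    then show ?thesis using Suc.IH[of "t n"] Suc.prems by (auto simp: subdivision_def less_Suc_eq)
  next
    case False
    then show ?thesis using Suc.prems by (auto simp: subdivision_def intro!: exI[of _ n])
  qed
qed (auto simp: subdivision_def)

lemma subdivision_covers_left:
  assumes "subdivision a b n t" "a < u" "u \<le> b"
  shows "\<exists>j<n. t j < u \<and> u \<le> t (Suc j)"
  using assms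
proof (induction n arbitrary: b)
  case (Suc n)
  show ?case
  proof (cases "u \<le> t n")
    case True
    then show ?thesis using Suc.IH[of "t n"] Suc.prems by (auto simp: subdivision_def less_Suc_eq)
  next
    case False
    then show ?thesis using Suc.prems by (auto simp: subdivision_def intro!: exI[of _ n])
  qed
qed (auto simp: subdivision_def)

section \<open>Piecewise smooth curves\<close>

lemma smooth_intoE:
  assumes "smooth_into A X f" "u \<in> X"
  obtains c W g where "c \<in> A" "open W" "u \<in> W" "f ` (W \<inter> X) \<subseteq> fst c"
    "smooth_on W g" "\<And>v. v \<in> W \<inter> X \<Longrightarrow> g v = snd c (f v)"
proof -
  have "\<exists>c\<in>A. \<exists>W g. open W \<and> u \<in> W \<and> f ` (W \<inter> X) \<subseteq> fst c \<and>
      smooth_on W g \<and> (\<forall>v\<in>W \<inter> X. g v = snd c (f v))"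
    using assms unfolding smooth_into_def case_prod_beta by blast
  with that show ?thesis by blast
qed

lemma smooth_intoI:
  assumes "\<And>u. u \<in> X \<Longrightarrow> \<exists>c\<in>A. \<exists>W g. open W \<and> u \<in> W \<and> f ` (W \<inter> X) \<subseteq> fst c \<and>
      smooth_on W g \<and> (\<forall>v\<in>W \<inter> X. g v = snd c (f v))"
  shows "smooth_into A X f"
  unfolding smooth_into_def case_prod_beta using assms by blast

lemma smooth_into_cong:
  fixes A :: "('a, 'e::euclidean_space) chart set"
  assumes "\<And>u. u \<in> X \<Longrightarrow> f u = g u" shows "smooth_into A X f \<longleftrightarrow> smooth_into A X g"
proof -
  have "f ` (W \<inter> X) = g ` (W \<inter> X)" for W using assms by (intro image_cong) auto
  moreover have "(\<forall>q\<in>W \<inter> X. h q = \<phi> (f q)) \<longleftrightarrow> (\<forall>q\<in>W \<inter> X. h q = \<phi> (g q))" for W h and \<phi> :: "'a \<Rightarrow> 'e"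
    using assms by auto
  ultimately show ?thesis unfolding smooth_into_def by simp
qed

lemma smooth_into_affine:
  fixes L :: "'p::euclidean_space \<Rightarrow> 'q::euclidean_space"
  assumes L: "bounded_linear L" and f: "smooth_into A X f" and Y: "(\<lambda>y. a + L y) ` Y \<subseteq> X"
  shows "smooth_into A Y (\<lambda>y. f (a + L y))"
proof (rule smooth_intoI)
  fix y assume y: "y \<in> Y"
  then have yX: "a + L y \<in> X" using Y by auto
  obtain c W g where c: "c \<in> A" and W: "open W" "a + L y \<in> W" "f ` (W \<inter> X) \<subseteq> fst c"
    and g: "smooth_on W g" "\<And>v. v \<in> W \<inter> X \<Longrightarrow> g v = snd c (f v)"
    by (rule smooth_intoE[OF f yX]) blast
  let ?W = "(\<lambda>y. a + L y) -` W"
  have "continuous_on UNIV (\<lambda>y. a + L y)" by (intro continuous_intros linear_continuous_on L)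
  then have "open ?W" using W(1) by (simp add: open_vimage)
  moreover have "(\<lambda>y. f (a + L y)) ` (?W \<inter> Y) \<subseteq> fst c" using W(3) Y by auto
  moreover have "\<forall>q\<in>?W \<inter> Y. g (a + L q) = snd c (f (a + L q))" using g(2) Y by auto
  moreover have "smooth_on ?W (\<lambda>y. g (a + L y))" using smooth_on_compose_affine[OF L W(1) g(1)] .
  moreover have "y \<in> ?W" using W(2) by simp
  ultimately show "\<exists>c\<in>A. \<exists>W g. open W \<and> y \<in> W \<and> (\<lambda>y. f (a + L y)) ` (W \<inter> Y) \<subseteq> fst c \<and>
      smooth_on W g \<and> (\<forall>v\<in>W \<inter> Y. g v = snd c (f (a + L v)))"
    using c by blast
qed

lemma smooth_into_slice:
  fixes I J :: "real set"
  assumes H: "smooth_into A (I \<times> J) (\<lambda>(s, u). H s u)" and s: "s \<in> I"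
  shows "smooth_into A J (H s)"
proof -
  have "bounded_linear (\<lambda>u::real. (0::real, u))"
    by (intro bounded_linear_Pair bounded_linear_zero bounded_linear_ident)
  from smooth_into_affine[OF this H, of "(s, 0)" J] s show ?thesis by auto
qed

text \<open>
  The subdivision of the second curve is appended to that of the first one; they share the
  point \<open>b\<close>, which is why the index \<open>n\<close> may be read in either of them.
\<close>

lemma piecewise_smooth_join:
  assumes "piecewise_smooth A \<gamma> a b" "piecewise_smooth A \<gamma> b e"
  shows "piecewise_smooth A \<gamma> a e"
proof -
  obtain n t where t: "subdivision a b n t" "\<And>i. i < n \<Longrightarrow> smooth_into A {t i..t (Suc i)} \<gamma>" and "a < b"
    using assms(1) unfolding piecewise_smooth_def by blast
  obtain m s where s: "subdivision b e m s" "\<And>i. i < m \<Longrightarrow> smooth_into A {s i..s (Suc i)} \<gamma>" and "b < e"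
    using assms(2) unfolding piecewise_smooth_def by blast
  define r where "r i = (if i \<le> n then t i else s (i - n))" for i
  have r1: "r i = t i" "r (Suc i) = t (Suc i)" if "i < n" for i
    using that by (auto simp: r_def)
  have r2: "r i = s (i - n)" "r (Suc i) = s (Suc (i - n))" if "\<not> i < n" for i
    using that t(1) s(1) by (auto simp: r_def subdivision_def Suc_diff_le not_less)
  have "r i < r (Suc i) \<and> smooth_into A {r i..r (Suc i)} \<gamma>" if "i < n + m" for i
    using t s that r1 r2 by (cases "i < n") (auto simp: subdivision_def)
  moreover have "r 0 = a" "r (n + m) = e"
    using t(1) s(1) by (auto simp: r_def subdivision_def)
  ultimately show ?thesis
    unfolding piecewise_smooth_def subdivision_def using \<open>a < b\<close> \<open>b < e\<close>
    by (intro conjI exI[of _ "n + m"] exI[of _ r]) auto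
qed

lemma piecewise_smooth_cong:
  assumes "\<And>u. u \<in> {a..b} \<Longrightarrow> \<gamma> u = \<gamma>' u"
  shows "piecewise_smooth A \<gamma> a b \<longleftrightarrow> piecewise_smooth A \<gamma>' a b"
proof -
  have "smooth_into A {t i..t (Suc i)} \<gamma> \<longleftrightarrow> smooth_into A {t i..t (Suc i)} \<gamma>'"
    if "subdivision a b n t" "i < n" for n t i
    using subdivision_subset[OF that] assms by (intro smooth_into_cong) auto
  then show ?thesis unfolding piecewise_smooth_def by (metis (no_types, lifting))
qed

lemma piecewise_smooth_shift:
  assumes "piecewise_smooth A \<gamma> a b"
  shows "piecewise_smooth A (\<lambda>u. \<gamma> (h + u)) (a - h) (b - h)"
proof -
  obtain n t where t: "subdivision a b n t" "\<And>i. i < n \<Longrightarrow> smooth_into A {t i..t (Suc i)} \<gamma>" and "a < b"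
    using assms unfolding piecewise_smooth_def by blast
  have "smooth_into A {t i - h..t (Suc i) - h} (\<lambda>u. \<gamma> (h + u))" if "i < n" for i
    by (rule smooth_into_affine[OF bounded_linear_ident t(2)[OF that]]) auto
  moreover have "subdivision (a - h) (b - h) n (\<lambda>i. t i - h)"
    using t(1) by (auto simp: subdivision_def)
  ultimately show ?thesis
    unfolding piecewise_smooth_def using \<open>a < b\<close> by (intro conjI exI[of _ n] exI[of _ "\<lambda>i. t i - h"]) auto
qed

text \<open>
  Away from the end points, the derivative does not depend on the interval in which it is taken.
  So the length integral may be cut at break points, where a two-sided derivative need not
  exist.
\<close>

lemma velocity_subinterval:
  assumes "u \<in> {p<..<q}" "{p..q} \<subseteq> {a..b}"
  shows "velocity A {a..b} \<gamma> u = velocity A {p..q} \<gamma> u"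
proof -
  have "a \<le> p" "q \<le> b" using assms by auto
  then have "at u within {a..b} = at u within {p..q}"
    using assms at_within_Icc_at[of a u b] at_within_Icc_at[of p u q] by auto
  then show ?thesis by (simp only: velocity_def)
qed

lemma velocity_cong:
  fixes A :: "('a, 'e::euclidean_space) chart set" and \<gamma> \<gamma>' :: "real \<Rightarrow> 'a"
  assumes "\<And>u. u \<in> X \<Longrightarrow> \<gamma> u = \<gamma>' u" "u \<in> X"
  shows "velocity A X \<gamma> u = velocity A X \<gamma>' u"
proof -
  have "((snd c \<circ> \<gamma>) has_vector_derivative w) (at u within X) \<longleftrightarrow>
        ((snd c \<circ> \<gamma>') has_vector_derivative w) (at u within X)" for c :: "('a, 'e) chart" and w
    using has_vector_derivative_transform[OF assms(2), of "snd c \<circ> \<gamma>" "snd c \<circ> \<gamma>'"]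
      has_vector_derivative_transform[OF assms(2), of "snd c \<circ> \<gamma>'" "snd c \<circ> \<gamma>"] assms(1) by auto
  then have "vector_derivative (snd c \<circ> \<gamma>) (at u within X) = vector_derivative (snd c \<circ> \<gamma>') (at u within X)"
    for c :: "('a, 'e) chart"
    unfolding vector_derivative_def by simp
  then show ?thesis using assms by (auto simp: velocity_def)
qed

section \<open>Charts and velocities\<close>

locale smooth_atlas =
  fixes T :: "'a topology" and A :: "('a, 'e::euclidean_space) chart set"
  assumes manifold: "smooth_manifold T A"
begin

abbreviation chart_inv :: "('a, 'e) chart \<Rightarrow> 'e \<Rightarrow> 'a" where
  "chart_inv c \<equiv> inv_into (fst c) (snd c)"

lemma chart_openin: "c \<in> A \<Longrightarrow> openin T (fst c)"
  and chart_open: "c \<in> A \<Longrightarrow> open (snd c ` fst c)"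
  and chart_homeo: "c \<in> A \<Longrightarrow> homeomorphic_map (subtopology T (fst c)) (top_of_set (snd c ` fst c)) (snd c)"
  using manifold unfolding smooth_manifold_def by (auto simp: case_prod_beta)

lemma chart_subset: "c \<in> A \<Longrightarrow> fst c \<subseteq> topspace T"
  using chart_openin openin_subset by blast

lemma ex_chart: "p \<in> topspace T \<Longrightarrow> \<exists>c\<in>A. p \<in> fst c"
  using manifold unfolding smooth_manifold_def by (force simp: case_prod_beta)

lemma chart_inj: assumes "c \<in> A" shows "inj_on (snd c) (fst c)"
proof -
  have "topspace (subtopology T (fst c)) = fst c"
    using chart_subset[OF assms] by auto
  then show ?thesis
    using chart_homeo[OF assms] unfolding homeomorphic_eq_everything_map by simp
qed

lemma chart_inv_chart [simp]: "c \<in> A \<Longrightarrow> p \<in> fst c \<Longrightarrow> chart_inv c (snd c p) = p"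
  by (rule inv_into_f_f[OF chart_inj])

lemma chart_vimage_openin:
  assumes "c \<in> A" "open W"
  shows "openin T {p \<in> fst c. snd c p \<in> W}"
proof -
  have "continuous_map (subtopology T (fst c)) (top_of_set (snd c ` fst c)) (snd c)"
    using chart_homeo[OF assms(1)] homeomorphic_imp_continuous_map by blast
  then have "continuous_map (subtopology T (fst c)) euclidean (snd c)"
    using continuous_map_in_subtopology by blast
  then have "openin (subtopology T (fst c)) {p \<in> topspace (subtopology T (fst c)). snd c p \<in> W}"
    using assms(2) unfolding continuous_map_def by auto
  moreover have "{p \<in> topspace (subtopology T (fst c)). snd c p \<in> W} = {p \<in> fst c. snd c p \<in> W}"
    using chart_subset[OF assms(1)] by auto
  ultimately show ?thesis
    using chart_openin[OF assms(1)] openin_trans_full by metis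
qed

lemma chart_image_open:
  assumes "c \<in> A" "openin T V"
  shows "open (snd c ` (fst c \<inter> V))"
proof -
  have "openin (subtopology T (fst c)) (fst c \<inter> V)"
    using assms(2) by (auto simp: openin_subtopology Int_commute)
  then have "openin (top_of_set (snd c ` fst c)) (snd c ` (fst c \<inter> V))"
    using homeomorphic_imp_open_map[OF chart_homeo[OF assms(1)]] unfolding open_map_def by blast
  then show ?thesis using chart_open[OF assms(1)] openin_open_trans by blast
qed

lemma transition_has_derivative:
  assumes "c \<in> A" "d \<in> A" "p \<in> fst c" "p \<in> fst d"
  shows "(transition c d has_derivative frechet_derivative (transition c d) (at (snd c p))) (at (snd c p))"
proof (rule smooth_on_has_derivative)
  show "smooth_on (snd c ` (fst c \<inter> fst d)) (transition c d)"
    using manifold assms unfolding smooth_manifold_def by blast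
qed (use assms in auto)

lemma transition_chart: "c \<in> A \<Longrightarrow> p \<in> fst c \<Longrightarrow> transition c d (snd c p) = snd d p"
  by (simp add: transition_def)

text \<open>
  Compatibility of the components is the chain rule for transition maps, which satisfy
  \<open>transition d1 d2 \<circ> transition c d1 = transition c d2\<close> near \<open>snd c p\<close>.
\<close>

lemma tangent_of_in_tangent_space:
  assumes c: "c \<in> A" "p \<in> fst c"
  shows "tangent_of A c p w \<in> tangent_space A p"
proof -
  have cocycle: "frechet_derivative (transition c d2) (at (snd c p)) w =
      frechet_derivative (transition d1 d2) (at (snd d1 p)) (frechet_derivative (transition c d1) (at (snd c p)) w)"
    if d: "d1 \<in> A" "d2 \<in> A" "p \<in> fst d1" "p \<in> fst d2" for d1 d2
  proof -
    have "((\<lambda>x. transition d1 d2 (transition c d1 x)) has_derivative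
       (\<lambda>v. frechet_derivative (transition d1 d2) (at (snd d1 p)) (frechet_derivative (transition c d1) (at (snd c p)) v)))
       (at (snd c p))"
      using has_derivative_compose[OF transition_has_derivative[OF c(1) d(1) c(2) d(3)]]
        transition_has_derivative[OF d] transition_chart[OF c] by metis
    then have "(transition c d2 has_derivative
       (\<lambda>v. frechet_derivative (transition d1 d2) (at (snd d1 p)) (frechet_derivative (transition c d1) (at (snd c p)) v)))
       (at (snd c p))"
    proof (rule has_derivative_transform_within_open)
      show "open (snd c ` (fst c \<inter> fst d1))" using chart_image_open chart_openin c d by blast
      show "transition d1 d2 (transition c d1 x) = transition c d2 x" if "x \<in> snd c ` (fst c \<inter> fst d1)" for x
        using that c d by (auto simp: transition_chart)
    qed (use c d in auto)
    from frechet_derivative_at[OF this] show ?thesis by metis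
  qed
  show ?thesis
    unfolding tangent_space_def mem_Collect_eq
  proof (intro conjI ballI allI impI)
    fix d1 d2 assume "d1 \<in> A" "d2 \<in> A" "p \<in> fst d1 \<inter> fst d2"
    then show "tangent_of A c p w d2 =
        frechet_derivative (transition d1 d2) (at (snd d1 p)) (tangent_of A c p w d1)"
      using cocycle[of d1 d2] by (simp only: tangent_of_def Int_iff simp_thms if_True)
  qed (auto simp: tangent_of_def)
qed

lemma tangent_of_scaleR:
  assumes "c \<in> A" "p \<in> fst c"
  shows "tangent_of A c p (r *\<^sub>R w) = (\<lambda>d. r *\<^sub>R tangent_of A c p w d)"
proof
  fix d
  have "linear (frechet_derivative (transition c d) (at (snd c p)))" if "d \<in> A" "p \<in> fst d"
    using transition_has_derivative[OF assms(1) that(1) assms(2) that(2)] has_derivative_linear by blast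
  then show "tangent_of A c p (r *\<^sub>R w) d = r *\<^sub>R tangent_of A c p w d"
    by (auto simp: tangent_of_def linear_scale)
qed

text \<open>
  The derivative of a curve in one chart determines its derivative in every other chart by the
  chain rule, hence the whole velocity vector.
\<close>

lemma velocity_eq_tangent_of:
  assumes c: "c \<in> A" "\<gamma> u \<in> fst c" and u: "at u within X \<noteq> bot" "u \<in> X"
    and near: "eventually (\<lambda>v. \<gamma> v \<in> fst c \<and> g v = snd c (\<gamma> v)) (at u within X)"
    and gu: "g u = snd c (\<gamma> u)"
    and D: "(g has_vector_derivative w) (at u within X)"
  shows "velocity A X \<gamma> u = tangent_of A c (\<gamma> u) w"
proof
  fix d
  show "velocity A X \<gamma> u d = tangent_of A c (\<gamma> u) w d"
  proof (cases "d \<in> A \<and> \<gamma> u \<in> fst d")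
    case True
    let ?L = "frechet_derivative (transition c d) (at (snd c (\<gamma> u)))"
    have trans: "(transition c d has_derivative ?L) (at (g u))"
      using transition_has_derivative c True gu by metis
    have "((\<lambda>v. transition c d (g v)) has_vector_derivative ?L w) (at u within X)"
      using vector_derivative_diff_chain_within[OF D has_derivative_at_withinI[OF trans]] by (simp add: o_def)
    moreover have "eventually (\<lambda>v. transition c d (g v) = (snd d \<circ> \<gamma>) v) (at u within X)"
      using near by eventually_elim (use c in \<open>auto simp: transition_chart\<close>)
    moreover have "transition c d (g u) = (snd d \<circ> \<gamma>) u"
      using c gu by (simp add: transition_chart)
    ultimately have "((snd d \<circ> \<gamma>) has_vector_derivative ?L w) (at u within X)"
      unfolding has_vector_derivative_def
      by (rule has_derivative_transform_eventually) (use u in auto)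
    then show ?thesis
      using True vector_derivative_within[OF u(1)] by (simp add: velocity_def tangent_of_def)
  qed (auto simp: velocity_def tangent_of_def)
qed

text \<open>
  The form in which the previous lemma is applied: \<open>g\<close> is a smooth map on an open set that
  represents \<open>\<gamma>\<close> in the chart, possibly only on one side of \<open>u\<close>.
\<close>

lemma velocity_in_chart:
  assumes c: "c \<in> A" and W: "open W" "u \<in> W" and u: "u \<in> {p..q}" "p < q"
    and g: "\<And>v. v \<in> W \<inter> {p..q} \<Longrightarrow> \<gamma> v \<in> fst c \<and> g v = snd c (\<gamma> v)"
    and D: "(g has_vector_derivative w) (at u within {p..q})"
  shows "velocity A {p..q} \<gamma> u = tangent_of A c (\<gamma> u) w"
proof (rule velocity_eq_tangent_of[OF c])
  show "at u within {p..q} \<noteq> bot"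
    using u by (simp add: trivial_limit_within)
  show "eventually (\<lambda>v. \<gamma> v \<in> fst c \<and> g v = snd c (\<gamma> v)) (at u within {p..q})"
    unfolding eventually_at_topological using W g by blast
qed (use g W u D in auto)

text \<open>
  On a smooth piece the local representative of \<open>\<gamma>\<close> has a two-sided derivative, to which
  the velocities within all subintervals are equal, even at their end points.
\<close>

lemma velocity_smooth_subinterval:
  assumes \<gamma>: "smooth_into A {a..b} \<gamma>" and sub: "{p..q} \<subseteq> {a..b}" and u: "u \<in> {p..q}" "p < q"
  shows "velocity A {a..b} \<gamma> u = velocity A {p..q} \<gamma> u"
proof -
  have u': "u \<in> {a..b}" "a < b" using sub u by auto
  obtain c W g where c: "c \<in> A" and W: "open W" "u \<in> W" "\<gamma> ` (W \<inter> {a..b}) \<subseteq> fst c"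
    and g: "smooth_on W g" "\<And>v. v \<in> W \<inter> {a..b} \<Longrightarrow> g v = snd c (\<gamma> v)"
    by (rule smooth_intoE[OF \<gamma> u'(1)]) blast
  have 1: "\<gamma> v \<in> fst c \<and> g v = snd c (\<gamma> v)" if "v \<in> W \<inter> {a..b}" for v
    using that W(3) g(2) by auto
  have 2: "\<gamma> v \<in> fst c \<and> g v = snd c (\<gamma> v)" if "v \<in> W \<inter> {p..q}" for v
    using 1 that sub by auto
  show ?thesis
    using velocity_in_chart[OF c W(1,2) u' 1 smooth_on_curve_has_vector_derivative[OF g(1) W(2)]]
      velocity_in_chart[OF c W(1,2) u 2 smooth_on_curve_has_vector_derivative[OF g(1) W(2)]]
    by simp
qed

text \<open>
  The break points of a variation need not be those for which \<open>\<gamma>\<close> is known to be regular.  But at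
  each point a piece of the one subdivision and a piece of the other share a small interval, and
  the velocity within that interval is the velocity within either piece.
\<close>

lemma regular_curve_velocity_nonzero:
  assumes reg: "regular_curve A \<gamma> a b" and \<gamma>: "smooth_into A {p..q} \<gamma>"
    and sub: "{p..q} \<subseteq> {a..b}" and u: "u \<in> {p..q}" "p < q"
  shows "velocity A {p..q} \<gamma> u \<noteq> (\<lambda>_. 0)"
proof -
  obtain n t where t: "subdivision a b n t" "\<And>j. j < n \<Longrightarrow> smooth_into A {t j..t (Suc j)} \<gamma>"
    "\<And>j u. j < n \<Longrightarrow> u \<in> {t j..t (Suc j)} \<Longrightarrow> velocity A {t j..t (Suc j)} \<gamma> u \<noteq> (\<lambda>_. 0)"
    using reg unfolding regular_curve_def by blast
  have ab: "a \<le> p" "q \<le> b" using sub u by auto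
  obtain j p' q' where j: "j < n" and pq': "p' < q'" "u \<in> {p'..q'}" "{p'..q'} \<subseteq> {p..q}" "{p'..q'} \<subseteq> {t j..t (Suc j)}"
  proof (cases "u < q")
    case True
    then obtain j where "j < n" "t j \<le> u" "u < t (Suc j)"
      using subdivision_covers_right[OF t(1), of u] ab u by auto
    then show ?thesis using that[of j u "min q (t (Suc j))"] True u by auto
  next
    case False
    then obtain j where "j < n" "t j < u" "u \<le> t (Suc j)"
      using subdivision_covers_left[OF t(1), of u] ab u by auto
    then show ?thesis using that[of j "max p (t j)" u] False u by auto
  qed
  have "velocity A {p..q} \<gamma> u = velocity A {t j..t (Suc j)} \<gamma> u"
    using velocity_smooth_subinterval[OF \<gamma> pq'(3,2,1)] velocity_smooth_subinterval[OF t(2)[OF j] pq'(4,2,1)] by simp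
  moreover have "u \<in> {t j..t (Suc j)}" using pq' by blast
  ultimately show ?thesis using t(3)[OF j] by simp
qed

end

section \<open>A pre-Finsler metric in a chart\<close>

locale pre_finsler_manifold = smooth_atlas T A
  for T :: "'a topology" and A :: "('a, 'e::euclidean_space) chart set" +
  fixes F :: "'a \<Rightarrow> ('a, 'e) tvec \<Rightarrow> real"
  assumes F: "pre_finsler A F"
begin

definition local_F :: "('a, 'e) chart \<Rightarrow> 'e \<times> 'e \<Rightarrow> real" where
  "local_F c = (\<lambda>(x, w). F (chart_inv c x) (tangent_of A c (chart_inv c x) w))"

lemma local_F_smooth:
  assumes "c \<in> A" shows "smooth_on (snd c ` fst c \<times> (UNIV - {0})) (local_F c)"
proof -
  have "\<forall>(U, \<phi>)\<in>A. smooth_on (\<phi> ` U \<times> (UNIV - {0}))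
        (\<lambda>(x, w). let p = inv_into U \<phi> x in F p (tangent_of A (U, \<phi>) p w))"
    using F unfolding pre_finsler_def by blast
  with assms show ?thesis by (auto simp: local_F_def Let_def)
qed

lemma local_F_scaleR:
  assumes "c \<in> A" "x \<in> snd c ` fst c" "r > 0"
  shows "local_F c (x, r *\<^sub>R w) = r * local_F c (x, w)"
proof -
  obtain p where p: "p \<in> fst c" "x = snd c p" using assms by auto
  have "\<forall>(U, \<phi>)\<in>A. \<forall>p\<in>U. \<forall>v\<in>tangent_space A p. \<forall>r>0. F p (\<lambda>c. r *\<^sub>R v c) = r * F p v"
    using F unfolding pre_finsler_def by blast
  then have "F p (\<lambda>d. r *\<^sub>R tangent_of A c p w d) = r * F p (tangent_of A c p w)"
    using assms(1,3) p(1) tangent_of_in_tangent_space by fastforce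
  then show ?thesis
    using p assms by (simp add: local_F_def tangent_of_scaleR)
qed

lemma local_F_zero:
  assumes "c \<in> A" "x \<in> snd c ` fst c" shows "local_F c (x, 0) = 0"
  using local_F_scaleR[OF assms, of 2 0] by simp

text \<open>
  By homogeneity the values are controlled by those on the unit sphere, which is compact.  This
  bound is also what makes \<open>F\<close> continuous on the zero section, where it need not be smooth.
\<close>

lemma local_F_bound:
  assumes c: "c \<in> A" and K: "compact K" "K \<subseteq> snd c ` fst c"
  obtains C where "C > 0" "\<And>x w. x \<in> K \<Longrightarrow> \<bar>local_F c (x, w)\<bar> \<le> C * norm w"
proof -
  have "continuous_on (K \<times> sphere 0 1) (local_F c)"
    using smooth_on_imp_continuous_on[OF local_F_smooth[OF c]]
    by (rule continuous_on_subset) (use K in auto)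
  then have "bounded (local_F c ` (K \<times> sphere 0 1))"
    using compact_continuous_image K compact_imp_bounded compact_Times compact_sphere by metis
  then obtain C where C: "C > 0" "\<And>x w. x \<in> K \<Longrightarrow> norm w = 1 \<Longrightarrow> \<bar>local_F c (x, w)\<bar> \<le> C"
    unfolding bounded_pos by (auto simp: image_iff)
  have "\<bar>local_F c (x, w)\<bar> \<le> C * norm w" if "x \<in> K" for x w
  proof (cases "w = 0")
    case True
    then show ?thesis using local_F_zero[OF c] K that by auto
  next
    case False
    have "local_F c (x, w) = norm w * local_F c (x, w /\<^sub>R norm w)"
      using local_F_scaleR[OF c, of x "norm w" "w /\<^sub>R norm w"] K that False by auto
    moreover have "\<bar>local_F c (x, w /\<^sub>R norm w)\<bar> \<le> C"
      using C(2)[OF that] False by simp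
    ultimately show ?thesis by (simp add: abs_mult mult.commute[of C] mult_left_mono)
  qed
  with C(1) that show ?thesis by blast
qed

lemma continuous_on_local_F:
  assumes c: "c \<in> A" shows "continuous_on (snd c ` fst c \<times> UNIV) (local_F c)"
proof -
  have "isCont (local_F c) (x, w)" if x: "x \<in> snd c ` fst c" for x w
  proof (cases "w = 0")
    case False
    have "open (snd c ` fst c \<times> (UNIV - {0::'e}))"
      using chart_open[OF c] by (auto intro!: open_Times)
    then show ?thesis
      using smooth_on_imp_continuous_on[OF local_F_smooth[OF c]] x False
      by (auto simp: continuous_on_eq_continuous_at)
  next
    case True
    obtain r where r: "r > 0" "cball x r \<subseteq> snd c ` fst c"
      using chart_open[OF c] x open_contains_cball by blast
    obtain C where C: "\<And>y w. y \<in> cball x r \<Longrightarrow> \<bar>local_F c (y, w)\<bar> \<le> C * norm w"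
      by (rule local_F_bound[OF c compact_cball r(2)]) blast
    have "((\<lambda>z. C * norm (snd z)) \<longlongrightarrow> C * norm (snd (x, w))) (at (x, w))"
      by (intro tendsto_intros)
    then have lim: "((\<lambda>z. C * norm (snd z)) \<longlongrightarrow> 0) (at (x, w))"
      using True by simp
    have "eventually (\<lambda>z. z \<in> ball x r \<times> UNIV) (at (x, w))"
      using r(1) by (intro eventually_at_in_open' open_Times) auto
    then have "eventually (\<lambda>z. norm (local_F c z) \<le> C * norm (snd z)) (at (x, w))"
    proof eventually_elim
      case (elim z)
      then show ?case using C[of "fst z" "snd z"] by (auto simp: mem_Times_iff)
    qed
    then have "(local_F c \<longlongrightarrow> 0) (at (x, w))"
      using lim by (rule Lim_null_comparison)
    then show ?thesis
      using local_F_zero[OF c x] True by (simp add: isCont_def)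
  qed
  then show ?thesis by (auto intro!: continuous_at_imp_continuous_on)
qed

section \<open>Length of piecewise smooth curves\<close>

abbreviation integrand :: "(real \<Rightarrow> 'a) \<Rightarrow> real \<Rightarrow> real \<Rightarrow> real \<Rightarrow> real" where
  "integrand \<gamma> a b u \<equiv> F (\<gamma> u) (velocity A {a..b} \<gamma> u)"

lemma integrand_eq_local_F:
  assumes c: "c \<in> A" and W: "open W" "u \<in> W" and u: "u \<in> {p..q}" "p < q"
    and g: "\<And>v. v \<in> W \<inter> {p..q} \<Longrightarrow> \<gamma> v \<in> fst c \<and> g v = snd c (\<gamma> v)"
    and D: "(g has_vector_derivative w) (at u within {p..q})"
  shows "integrand \<gamma> p q u = local_F c (g u, w)"
  using velocity_in_chart[OF c W u g D] g[of u] W u c by (simp add: local_F_def)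

lemma continuous_on_integrand:
  assumes \<gamma>: "smooth_into A {p..q} \<gamma>" and "p < q"
  shows "continuous_on {p..q} (integrand \<gamma> p q)"
proof (rule continuous_on_local)
  fix u assume "u \<in> {p..q}"
  obtain c W g where c: "c \<in> A" and W: "open W" "u \<in> W" "\<gamma> ` (W \<inter> {p..q}) \<subseteq> fst c"
    and g: "smooth_on W g" "\<And>v. v \<in> W \<inter> {p..q} \<Longrightarrow> g v = snd c (\<gamma> v)"
    by (rule smooth_intoE[OF \<gamma> \<open>u \<in> {p..q}\<close>]) blast
  have eq: "local_F c (g v, frechet_derivative g (at v) 1) = integrand \<gamma> p q v"
    if v: "v \<in> W \<inter> {p..q}" for v
  proof (rule integrand_eq_local_F[OF c W(1), symmetric])
    show "(g has_vector_derivative frechet_derivative g (at v) 1) (at v within {p..q})"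
      using smooth_on_curve_has_vector_derivative[OF g(1)] v by simp
    show "\<gamma> v' \<in> fst c \<and> g v' = snd c (\<gamma> v')" if "v' \<in> W \<inter> {p..q}" for v'
      using that W(3) g(2) by auto
  qed (use v \<open>p < q\<close> in auto)
  have "continuous_on (W \<inter> {p..q}) (\<lambda>v. local_F c (g v, frechet_derivative g (at v) 1))"
  proof (rule continuous_on_compose2[OF continuous_on_local_F[OF c]])
    show "continuous_on (W \<inter> {p..q}) (\<lambda>v. (g v, frechet_derivative g (at v) 1))"
      by (intro continuous_on_Pair continuous_on_subset[OF smooth_on_imp_continuous_on[OF g(1)]]
          continuous_on_frechet_derivative[OF g(1)] continuous_intros) auto
  qed (use W g in auto)
  then have "continuous_on (W \<inter> {p..q}) (integrand \<gamma> p q)"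
    by (rule continuous_on_eq) (rule eq)
  then show "\<exists>W. open W \<and> u \<in> W \<and> continuous_on (W \<inter> {p..q}) (integrand \<gamma> p q)"
    using W by blast
qed

lemma smooth_into_has_integral:
  assumes "smooth_into A {p..q} \<gamma>" "p < q"
  shows "(integrand \<gamma> p q has_integral len A F \<gamma> p q) {p..q}"
  unfolding len_def
  by (rule integrable_integral[OF integrable_continuous_interval[OF continuous_on_integrand[OF assms]]])

lemma integrand_join:
  assumes I: "(integrand \<gamma> a b has_integral I) {a..b}" and J: "(integrand \<gamma> b e has_integral J) {b..e}"
    and "a < b" "b < e"
  shows "(integrand \<gamma> a e has_integral I + J) {a..e}"
proof (rule has_integral_combine[of a b])
  show "(integrand \<gamma> a e has_integral I) {a..b}"
    by (rule has_integral_spike_finite[OF _ _ I, of "{a, b}"])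
      (use assms in \<open>auto simp: velocity_subinterval[of _ a b a e]\<close>)
  show "(integrand \<gamma> a e has_integral J) {b..e}"
    by (rule has_integral_spike_finite[OF _ _ J, of "{b, e}"])
      (use assms in \<open>auto simp: velocity_subinterval[of _ b e a e]\<close>)
qed (use assms in auto)

text \<open>
  Pieces are joined one at a time.  Integrability is part of the conclusion because
  the additivity of \<open>len\<close> depends on it.
\<close>

lemma subdivision_has_integral:
  assumes "subdivision a b n t" "0 < n" "\<And>i. i < n \<Longrightarrow> smooth_into A {t i..t (Suc i)} \<gamma>"
  shows "(integrand \<gamma> a b has_integral (\<Sum>i<n. len A F \<gamma> (t i) (t (Suc i)))) {a..b} \<and> a < b"
  using assms
proof (induction n arbitrary: b)
  case (Suc n)
  have last: "(integrand \<gamma> (t n) b has_integral len A F \<gamma> (t n) (t (Suc n))) {t n..b}" "t n < b"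
    using Suc.prems smooth_into_has_integral[of "t n" "t (Suc n)" \<gamma>] by (auto simp: subdivision_def)
  show ?case
  proof (cases "n = 0")
    case True
    then show ?thesis using last Suc.prems by (auto simp: subdivision_def)
  next
    case False
    have "subdivision a (t n) n t" using Suc.prems by (auto simp: subdivision_def)
    then have "(integrand \<gamma> a (t n) has_integral (\<Sum>i<n. len A F \<gamma> (t i) (t (Suc i)))) {a..t n}" "a < t n"
      using Suc.IH[of "t n"] Suc.prems False by auto
    then show ?thesis using integrand_join last by auto
  qed
qed simp

lemma piecewise_smooth_has_integral:
  assumes "piecewise_smooth A \<gamma> a b"
  shows "(integrand \<gamma> a b has_integral len A F \<gamma> a b) {a..b}"
proof -
  obtain n t where t: "subdivision a b n t" "\<And>i. i < n \<Longrightarrow> smooth_into A {t i..t (Suc i)} \<gamma>" and "a < b"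
    using assms unfolding piecewise_smooth_def by blast
  then have "0 < n" by (cases n) (auto simp: subdivision_def)
  then have "integrand \<gamma> a b integrable_on {a..b}"
    using subdivision_has_integral[OF t(1)] t(2) by blast
  then show ?thesis unfolding len_def by (rule integrable_integral)
qed

lemma len_join:
  assumes "piecewise_smooth A \<gamma> a b" "piecewise_smooth A \<gamma> b e"
  shows "len A F \<gamma> a e = len A F \<gamma> a b + len A F \<gamma> b e"
proof -
  have "a < b" "b < e" using assms by (auto simp: piecewise_smooth_def)
  then have "(integrand \<gamma> a e has_integral len A F \<gamma> a b + len A F \<gamma> b e) {a..e}"
    using integrand_join piecewise_smooth_has_integral assms by blast
  then show ?thesis unfolding len_def[of A F \<gamma> a e] by (rule integral_unique)
qed

lemma len_cong:
  assumes "\<And>u. u \<in> {a..b} \<Longrightarrow> \<gamma> u = \<gamma>' u"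
  shows "len A F \<gamma> a b = len A F \<gamma>' a b"
  unfolding len_def
  by (rule integral_cong) (use assms velocity_cong[of "{a..b}" \<gamma> \<gamma>' _ A] in auto)

text \<open>
  The vectors that are derivatives of the translate at \<open>u\<close> are those that are derivatives of \<open>\<gamma>\<close> at
  \<open>h + u\<close>.  So the velocities agree even where \<open>\<gamma>\<close> is not differentiable.
\<close>

lemma len_shift: "len A F (\<lambda>u. \<gamma> (h + u)) (a - h) (b - h) = len A F \<gamma> a b"
proof -
  have "velocity A {a - h..b - h} (\<lambda>u. \<gamma> (h + u)) u = velocity A {a..b} \<gamma> (h + u)" for u
  proof -
    have "((snd c \<circ> (\<lambda>u. \<gamma> (h + u))) has_vector_derivative w) (at u within {a - h..b - h}) \<longleftrightarrow>
          ((snd c \<circ> \<gamma>) has_vector_derivative w) (at (h + u) within {a..b})" for c :: "('a, 'e) chart" and w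
      using has_vector_derivative_shift[of "snd c \<circ> \<gamma>" w h u a b]
        has_vector_derivative_shift[of "snd c \<circ> (\<lambda>u. \<gamma> (h + u))" w "- h" "h + u" "a - h" "b - h"]
      by (auto simp: o_def)
    then show ?thesis by (simp only: velocity_def vector_derivative_def)
  qed
  then have "len A F (\<lambda>u. \<gamma> (h + u)) (a - h) (b - h)
    = integral {a - h..b - h} (integrand \<gamma> a b \<circ> (+) h)"
    by (simp add: len_def o_def)
  then show ?thesis by (simp add: integral_shift_Icc_real len_def)
qed

section \<open>The pre-distance\<close>

abbreviation dist_F :: "'a \<Rightarrow> 'a \<Rightarrow> ereal" where
  "dist_F \<equiv> pre_dist A F"

lemma pre_dist_le_len:
  assumes "piecewise_smooth A \<gamma> a b"
  shows "dist_F (\<gamma> a) (\<gamma> b) \<le> ereal (len A F \<gamma> a b)"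
proof -
  have "(\<gamma>, a, b) \<in> curves A (\<gamma> a) (\<gamma> b)" using assms by (simp add: curves_def)
  then show ?thesis unfolding pre_dist_def by (rule INF_lower2) simp
qed

lemma pre_dist_greatest:
  assumes "\<And>\<gamma> a b. piecewise_smooth A \<gamma> a b \<Longrightarrow> \<gamma> a = x \<Longrightarrow> \<gamma> b = y \<Longrightarrow> z \<le> ereal (len A F \<gamma> a b)"
  shows "z \<le> dist_F x y"
  unfolding pre_dist_def by (rule INF_greatest) (use assms in \<open>auto simp: curves_def\<close>)

text \<open>
  The second curve is translated by \<open>h\<close> so that its parameter interval begins where the first
  one ends.
\<close>

lemma pre_dist_le_len_add_len:
  assumes \<gamma>: "piecewise_smooth A \<gamma> a b" and \<delta>: "piecewise_smooth A \<delta> c e" and eq: "\<gamma> b = \<delta> c"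
  shows "dist_F (\<gamma> a) (\<delta> e) \<le> ereal (len A F \<gamma> a b) + ereal (len A F \<delta> c e)"
proof -
  define h where "h = c - b"
  define \<delta>' where "\<delta>' = (\<lambda>u. \<delta> (h + u))"
  define \<eta> where "\<eta> = (\<lambda>u. if u \<le> b then \<gamma> u else \<delta>' u)"
  have \<delta>': "piecewise_smooth A \<delta>' b (e - h)" "len A F \<delta>' b (e - h) = len A F \<delta> c e"
    using piecewise_smooth_shift[OF \<delta>, of h] len_shift[of \<delta> h c e] by (simp_all add: \<delta>'_def h_def)
  have 1: "\<eta> u = \<gamma> u" if "u \<in> {a..b}" for u using that by (simp add: \<eta>_def)
  have 2: "\<eta> u = \<delta>' u" if "u \<in> {b..e - h}" for u
    using that eq by (auto simp: \<eta>_def \<delta>'_def h_def)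
  have p: "piecewise_smooth A \<eta> a b" "piecewise_smooth A \<eta> b (e - h)"
    using piecewise_smooth_cong[of a b \<eta> \<gamma> A, OF 1] piecewise_smooth_cong[of b "e - h" \<eta> \<delta>' A, OF 2] \<gamma> \<delta>'
    by simp_all
  have ends: "\<eta> a = \<gamma> a" "\<eta> (e - h) = \<delta> e"
    using \<gamma> \<delta>' 1[of a] 2[of "e - h"] by (auto simp: piecewise_smooth_def \<delta>'_def)
  have "len A F \<eta> a (e - h) = len A F \<gamma> a b + len A F \<delta> c e"
    using len_join[OF p] len_cong[of a b \<eta> \<gamma>, OF 1] len_cong[of b "e - h" \<eta> \<delta>', OF 2] \<delta>' by simp
  then show ?thesis
    using pre_dist_le_len[OF piecewise_smooth_join[OF p]] ends by simp
qed

text \<open>With \<open>\<infinity> + -\<infinity> = \<infinity>\<close>, the inequality also covers points not joined by a curve.\<close>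

lemma pre_dist_triangle: "dist_F x z \<le> dist_F x y + dist_F y z"
proof -
  have 1: "dist_F x z \<le> ereal (len A F \<gamma> a b) + dist_F y z"
    if \<gamma>: "piecewise_smooth A \<gamma> a b" "\<gamma> a = x" "\<gamma> b = y" for \<gamma> a b
  proof -
    \<comment> \<open>The infima over the two curves are taken one after the other, so that only the finite length
      of the first curve has to be subtracted here.\<close>
    have "dist_F x z - ereal (len A F \<gamma> a b) \<le> dist_F y z"
    proof (rule pre_dist_greatest)
      fix \<delta> c e assume "piecewise_smooth A \<delta> c e" "\<delta> c = y" "\<delta> e = z"
      then have "dist_F x z \<le> ereal (len A F \<gamma> a b) + ereal (len A F \<delta> c e)"
        using pre_dist_le_len_add_len[OF \<gamma>(1), of \<delta> c e] \<gamma> by simp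
      then show "dist_F x z - ereal (len A F \<gamma> a b) \<le> ereal (len A F \<delta> c e)"
        by (cases "dist_F x z") auto
    qed
    then show ?thesis by (cases "dist_F x z"; cases "dist_F y z") auto
  qed
  show ?thesis
  proof (cases "dist_F x y = \<infinity> \<or> dist_F y z = \<infinity>")
    case True
    then show ?thesis by auto
  next
    case False
    show ?thesis
    proof (cases "dist_F y z = -\<infinity>")
      case True
      obtain \<gamma> a b where "piecewise_smooth A \<gamma> a b" "\<gamma> a = x" "\<gamma> b = y"
        using False pre_dist_greatest[of x y \<infinity>] by fastforce
      then show ?thesis using 1 True by fastforce
    next
      case nminf: False
      have "dist_F x z - dist_F y z \<le> dist_F x y"
      proof (rule pre_dist_greatest)
        fix \<gamma> a b assume "piecewise_smooth A \<gamma> a b" "\<gamma> a = x" "\<gamma> b = y"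
        from 1[OF this] show "dist_F x z - dist_F y z \<le> ereal (len A F \<gamma> a b)"
          using False nminf by (cases "dist_F x z"; cases "dist_F y z") auto
      qed
      then show ?thesis
        using False nminf by (cases "dist_F x z"; cases "dist_F y z"; cases "dist_F x y") auto
    qed
  qed
qed

text \<open>Segments in a chart join nearby points, at a cost proportional to their distance in the chart.\<close>

lemma pre_dist_le_segment:
  assumes c: "c \<in> A" and K: "convex K" "K \<subseteq> snd c ` fst c"
    and C: "\<And>x w. x \<in> K \<Longrightarrow> \<bar>local_F c (x, w)\<bar> \<le> C * norm w"
    and y: "y \<in> K" and z: "z \<in> K"
  shows "dist_F (chart_inv c y) (chart_inv c z) \<le> ereal (C * norm (z - y))"
proof -
  define g where "g = (\<lambda>u. y + u *\<^sub>R (z - y))"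
  define \<gamma> where "\<gamma> = (\<lambda>u. chart_inv c (g u))"
  have gK: "g u \<in> K" if "u \<in> {0..1}" for u
    using convexD_alt[OF K(1) y z, of u] that by (simp add: g_def algebra_simps)
  have \<gamma>: "\<gamma> u \<in> fst c \<and> g u = snd c (\<gamma> u)" if "u \<in> {0..1}" for u
    using gK[OF that] K(2) by (auto simp: \<gamma>_def inv_into_into f_inv_into_f)
  have g: "smooth_on UNIV g"
    unfolding g_def by (rule smooth_on_affine) (rule bounded_linear_scaleR_left)
  have smooth: "smooth_into A {0..1} \<gamma>"
  proof (rule smooth_intoI)
    fix u :: real
    have "\<gamma> ` (UNIV \<inter> {0..1}) \<subseteq> fst c" "\<forall>v\<in>UNIV \<inter> {0..1}. g v = snd c (\<gamma> v)" using \<gamma> by auto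
    then show "\<exists>c\<in>A. \<exists>W g. open W \<and> u \<in> W \<and> \<gamma> ` (W \<inter> {0..1}) \<subseteq> fst c \<and>
      smooth_on W g \<and> (\<forall>v\<in>W \<inter> {0..1}. g v = snd c (\<gamma> v))"
      using c g open_UNIV UNIV_I by blast
  qed
  have ps: "piecewise_smooth A \<gamma> 0 1"
    unfolding piecewise_smooth_def subdivision_def
    by (intro conjI exI[of _ 1] exI[of _ real]) (use smooth in auto)
  have "integrand \<gamma> 0 1 u \<le> C * norm (z - y)" if "u \<in> {0..1}" for u
  proof -
    have "integrand \<gamma> 0 1 u = local_F c (g u, z - y)"
    proof (rule integrand_eq_local_F[OF c open_UNIV UNIV_I that])
      show "(g has_vector_derivative z - y) (at u within {0..1})"
        unfolding g_def by (auto intro!: derivative_eq_intros)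
    qed (use \<gamma> in auto)
    then show ?thesis using C[OF gK[OF that], of "z - y"] by simp
  qed
  then have "len A F \<gamma> 0 1 \<le> C * norm (z - y)"
    using has_integral_le[OF piecewise_smooth_has_integral[OF ps], of "\<lambda>_. C * norm (z - y)"]
      has_integral_const_real[of "C * norm (z - y)" 0 1] by simp
  then show ?thesis
    using pre_dist_le_len[OF ps] by (simp add: \<gamma>_def g_def order_trans)
qed

text \<open>
  Both directions are needed because \<open>F\<close>, hence also the pre-distance, need not be symmetric.
\<close>

lemma pre_dist_small:
  assumes x: "x \<in> topspace T" and e: "e > 0"
  obtains N where "openin T N" "x \<in> N" "\<And>p. p \<in> N \<Longrightarrow> dist_F x p < ereal e \<and> dist_F p x < ereal e"
proof -
  obtain c where c: "c \<in> A" "x \<in> fst c" using ex_chart[OF x] by blast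
  obtain r where r: "r > 0" "cball (snd c x) r \<subseteq> snd c ` fst c"
    using chart_open[OF c(1)] c(2) open_contains_cball by blast
  obtain C where C: "C > 0" "\<And>y w. y \<in> cball (snd c x) r \<Longrightarrow> \<bar>local_F c (y, w)\<bar> \<le> C * norm w"
    by (rule local_F_bound[OF c(1) compact_cball r(2)]) blast
  \<comment> \<open>Segments of length less than \<open>e / C\<close> cost less than \<open>e\<close>.\<close>
  define N where "N = {p \<in> fst c. snd c p \<in> ball (snd c x) (min r (e / C))}"
  have "dist_F x p < ereal e \<and> dist_F p x < ereal e" if p: "p \<in> N" for p
  proof -
    have pc: "p \<in> fst c" and d: "dist (snd c x) (snd c p) < r" "dist (snd c x) (snd c p) < e / C"
      using p by (auto simp: N_def)
    have "C * norm (snd c p - snd c x) < e" "C * norm (snd c x - snd c p) < e"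
      using d(2) C(1) by (simp_all add: dist_norm norm_minus_commute field_simps)
    moreover have "dist_F x p \<le> ereal (C * norm (snd c p - snd c x))"
      using pre_dist_le_segment[OF c(1) convex_cball r(2) C(2), of "snd c x" "snd c p"] c pc d r(1) by simp
    moreover have "dist_F p x \<le> ereal (C * norm (snd c x - snd c p))"
      using pre_dist_le_segment[OF c(1) convex_cball r(2) C(2), of "snd c p" "snd c x"] c pc d r(1) by simp
    ultimately show ?thesis by (meson ereal_less_eq(3) le_less_trans less_ereal.simps(1))
  qed
  moreover have "openin T N" unfolding N_def by (rule chart_vimage_openin[OF c(1) open_ball])
  moreover have "x \<in> N" using c r(1) e C(1) by (simp add: N_def)
  ultimately show ?thesis using that by blast
qed

text \<open>Points joined to \<open>x\<close> by a curve form a set which is open and has open complement.\<close>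

lemma pre_dist_not_infinity:
  assumes conn: "connected_space T" and x: "x \<in> topspace T" and y: "y \<in> topspace T"
  shows "dist_F x y \<noteq> \<infinity>"
proof -
  let ?R = "{q \<in> topspace T. dist_F x q \<noteq> \<infinity>}"
  have near: "\<exists>N. openin T N \<and> q \<in> N \<and> (\<forall>p\<in>N. dist_F x p \<noteq> \<infinity> \<longleftrightarrow> dist_F x q \<noteq> \<infinity>)"
    if q: "q \<in> topspace T" for q
  proof -
    obtain N where N: "openin T N" "q \<in> N" "\<And>p. p \<in> N \<Longrightarrow> dist_F q p < ereal 1 \<and> dist_F p q < ereal 1"
      using pre_dist_small[OF q, of 1] by (metis zero_less_one)
    have "dist_F x p \<noteq> \<infinity> \<longleftrightarrow> dist_F x q \<noteq> \<infinity>" if "p \<in> N" for p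
      using pre_dist_triangle[of x p q] pre_dist_triangle[of x q p] N(3)[OF that] by auto
    with N(1,2) show ?thesis by blast
  qed
  have "openin T ?R"
  proof (subst openin_subopen, intro ballI)
    fix q assume q: "q \<in> ?R"
    then obtain N where N: "openin T N" "q \<in> N" "\<forall>p\<in>N. dist_F x p \<noteq> \<infinity>" using near[of q] by auto
    then have "N \<subseteq> ?R" using openin_subset by auto
    with N show "\<exists>N. openin T N \<and> q \<in> N \<and> N \<subseteq> ?R" by blast
  qed
  moreover have "openin T (topspace T - ?R)"
  proof (subst openin_subopen, intro ballI)
    fix q assume q: "q \<in> topspace T - ?R"
    then obtain N where N: "openin T N" "q \<in> N" "\<forall>p\<in>N. dist_F x p = \<infinity>" using near[of q] by auto
    then have "N \<subseteq> topspace T - ?R" using openin_subset by auto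
    with N show "\<exists>N. openin T N \<and> q \<in> N \<and> N \<subseteq> topspace T - ?R" by blast
  qed
  ultimately have "?R = {} \<or> ?R = topspace T"
    using conn unfolding connected_space_clopen_in by (auto simp: closedin_def)
  moreover have "x \<in> ?R"
  proof -
    obtain N where "x \<in> N" "\<And>p. p \<in> N \<Longrightarrow> dist_F x p < ereal 1"
      using pre_dist_small[OF x, of 1] by (metis zero_less_one)
    then have "dist_F x x < ereal 1" by blast
    then show ?thesis using x by auto
  qed
  ultimately show ?thesis using y by blast
qed

text \<open>
  A path from \<open>p\<close> to \<open>q\<close> may make a detour through \<open>x\<close> and \<open>y\<close>; the additional distances are not
  \<open>\<infinity>\<close>, so they cannot compensate \<open>-\<infinity>\<close>.
\<close>

lemma pre_dist_minus_infinity_everywhere: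
  assumes conn: "connected_space T" and xy: "x \<in> topspace T" "y \<in> topspace T" "dist_F x y = -\<infinity>"
    and pq: "p \<in> topspace T" "q \<in> topspace T"
  shows "dist_F p q = -\<infinity>"
proof -
  have "dist_F p y = -\<infinity>"
    using pre_dist_triangle[of p y x] pre_dist_not_infinity[OF conn pq(1) xy(1)] xy(3)
    by (cases "dist_F p x") auto
  then show ?thesis
    using pre_dist_triangle[of p q y] pre_dist_not_infinity[OF conn xy(2) pq(2)]
    by (cases "dist_F y q") auto
qed

text \<open>
  A negative real number is larger than its double, against the triangle inequality.
\<close>

lemma pre_dist_self_negative:
  assumes "dist_F x x < 0"
  shows "dist_F x x = -\<infinity>"
  using pre_dist_triangle[of x x x] assms by (cases "dist_F x x") auto

text \<open>
  Both \<open>d(x,y) - d(p,q) \<le> d(x,p) + d(q,y)\<close> and its counterpart with the two pairs exchanged follow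
  from the triangle inequality, and all four distances on the right are small when \<open>p\<close> is close to
  \<open>x\<close> and \<open>q\<close> to \<open>y\<close>.
\<close>

lemma pre_dist_continuous:
  assumes finite: "\<And>x y. x \<in> topspace T \<Longrightarrow> y \<in> topspace T \<Longrightarrow> \<bar>dist_F x y\<bar> \<noteq> \<infinity>"
  shows "continuous_map (prod_topology T T) euclideanreal (\<lambda>(x, y). real_of_ereal (dist_F x y))"
proof -
  let ?d = "\<lambda>x y. real_of_ereal (dist_F x y)"
  have tri: "?d x z \<le> ?d x y + ?d y z" if "x \<in> topspace T" "y \<in> topspace T" "z \<in> topspace T" for x y z
    using pre_dist_triangle[of x z y] finite[of x y] finite[of y z] finite[of x z] that
    by (cases "dist_F x y"; cases "dist_F y z"; cases "dist_F x z") auto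
  have small: "\<exists>N. openin T N \<and> x \<in> N \<and> (\<forall>p\<in>N. ?d x p < e \<and> ?d p x < e)"
    if x: "x \<in> topspace T" and e: "e > 0" for x e
  proof -
    obtain N where N: "openin T N" "x \<in> N" "\<And>p. p \<in> N \<Longrightarrow> dist_F x p < ereal e \<and> dist_F p x < ereal e"
      using pre_dist_small[OF x e] by metis
    have "?d x p < e \<and> ?d p x < e" if "p \<in> N" for p
    proof -
      have "p \<in> topspace T" using N(1) that openin_subset by blast
      then show ?thesis
        using N(3)[OF that] finite[OF x, of p] finite[OF _ x, of p]
        by (cases "dist_F x p"; cases "dist_F p x") auto
    qed
    with N show ?thesis by blast
  qed
  \<comment> \<open>\<open>Met_TC\<close> is the type class metric, here that of the reals.\<close>
  have "continuous_map (prod_topology T T) Met_TC.mtopology (\<lambda>(x, y). ?d x y)"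
    unfolding Met_TC.continuous_map_to_metric
  proof (intro ballI allI impI)
    fix z :: "'a \<times> 'a" and e :: real assume z: "z \<in> topspace (prod_topology T T)" and e: "e > 0"
    obtain x y where xy: "z = (x, y)" "x \<in> topspace T" "y \<in> topspace T" using z by auto
    obtain M where M: "openin T M" "x \<in> M" "\<forall>p\<in>M. ?d x p < e/2 \<and> ?d p x < e/2"
      using small[OF xy(2), of "e/2"] e by auto
    obtain N where N: "openin T N" "y \<in> N" "\<forall>p\<in>N. ?d y p < e/2 \<and> ?d p y < e/2"
      using small[OF xy(3), of "e/2"] e by auto
    have "\<bar>?d x y - ?d p q\<bar> < e" if pq: "p \<in> M" "q \<in> N" for p q
    proof -
      have S: "p \<in> topspace T" "q \<in> topspace T" using pq M(1) N(1) openin_subset by blast+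
      show ?thesis
        using tri[of x p y] tri[of p q y] tri[of p x q] tri[of x y q] S xy(2,3) M(3) N(3) pq by force
    qed
    then show "\<exists>U. openin (prod_topology T T) U \<and> z \<in> U \<and>
        (\<forall>w\<in>U. (case w of (x, y) \<Rightarrow> ?d x y) \<in> Met_TC.mball (case z of (x, y) \<Rightarrow> ?d x y) e)"
      using M(1,2) N(1,2) xy(1)
      by (intro exI[of _ "M \<times> N"]) (auto simp: openin_prod_Times_iff dist_real_def)
  qed
  then show ?thesis by simp
qed

section \<open>Differentiating the length along a variation\<close>

text \<open>
  In a chart \<open>c\<close> the variation is a smooth map \<open>g\<close>, with partial derivatives \<open>g1\<close> in \<open>s\<close> and \<open>g2\<close> in \<open>u\<close>,
  and the integrand is \<open>local_F c (g, g2)\<close>.  This is smooth where \<open>g2\<close> has no zero, and the chain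
  rule yields its derivative in \<open>s\<close>.
\<close>

lemma integrand_variation_local:
  fixes I :: "real set"
  assumes H: "smooth_into A (I \<times> {p..q}) (\<lambda>(s, u). H s u)" and I: "open I" "s0 \<in> I"
    and u0: "u0 \<in> {p..q}" and pq: "p < q" and nz: "velocity A {p..q} (H s0) u0 \<noteq> (\<lambda>_. 0)"
  shows "\<exists>W D. open W \<and> (s0, u0) \<in> W \<and> continuous_on W D \<and>
    (\<forall>s u. (s, u) \<in> W \<inter> I \<times> {p..q} \<longrightarrow>
       ((\<lambda>s. integrand (H s) p q u) has_real_derivative D (s, u)) (at s))"
proof -
  have "(s0, u0) \<in> I \<times> {p..q}" using I u0 by auto
  obtain c W g where c: "c \<in> A" and W: "open W" "(s0, u0) \<in> W"
      "(\<lambda>(s, u). H s u) ` (W \<inter> I \<times> {p..q}) \<subseteq> fst c"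
    and g: "smooth_on W g" "\<And>v. v \<in> W \<inter> I \<times> {p..q} \<Longrightarrow> g v = snd c ((\<lambda>(s, u). H s u) v)"
    by (rule smooth_intoE[OF H \<open>(s0, u0) \<in> I \<times> {p..q}\<close>]) blast
  define g1 where "g1 = (\<lambda>z. frechet_derivative g (at z) (1, 0))"
  define g2 where "g2 = (\<lambda>z. frechet_derivative g (at z) (0, 1))"
  define g12 where "g12 = (\<lambda>z. frechet_derivative g2 (at z) (1, 0))"
  have sm: "smooth_on W g1" "smooth_on W g2" "smooth_on W g12"
    unfolding g1_def g12_def g2_def by (intro smooth_on_frechet_derivative g)+
  note cont = smooth_on_imp_continuous_on[OF g(1)] smooth_on_imp_continuous_on[OF sm(1)]
    smooth_on_imp_continuous_on[OF sm(2)] smooth_on_imp_continuous_on[OF sm(3)]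
  have Hg: "H s u \<in> fst c \<and> g (s, u) = snd c (H s u)" if "(s, u) \<in> W" "s \<in> I" "u \<in> {p..q}" for s u
    using that subsetD[OF W(3) imageI[of "(s, u)"]] g(2)[of "(s, u)"] by simp
  have loc: "velocity A {p..q} (H s) u = tangent_of A c (H s u) (g2 (s, u))"
    "integrand (H s) p q u = local_F c (g (s, u), g2 (s, u))"
    if su: "(s, u) \<in> W" "s \<in> I" "u \<in> {p..q}" for s u
  proof -
    have op: "open {v. (s, v) \<in> W}"
      using open_vimage[OF W(1), of "\<lambda>v. (s, v)"] by (simp add: vimage_def continuous_on_Pair)
    have Hg': "H s v \<in> fst c \<and> g (s, v) = snd c (H s v)" if "v \<in> {v. (s, v) \<in> W} \<inter> {p..q}" for v
      using Hg su that by auto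
    have D: "((\<lambda>v. g (s, v)) has_vector_derivative g2 (s, u)) (at u within {p..q})"
      unfolding g2_def by (rule smooth_on_partial_snd[OF g(1) su(1)])
    have u: "u \<in> {v. (s, v) \<in> W}" using su by simp
    show "velocity A {p..q} (H s) u = tangent_of A c (H s u) (g2 (s, u))"
      by (rule velocity_in_chart[OF c op u su(3) pq Hg' D])
    show "integrand (H s) p q u = local_F c (g (s, u), g2 (s, u))"
      by (rule integrand_eq_local_F[OF c op u su(3) pq Hg' D])
  qed
  let ?E = "snd c ` fst c \<times> (UNIV - {0::'e})"
  define W' where "W' = W \<inter> (\<lambda>z. (g z, g2 z)) -` ?E"
  have "open ?E" using chart_open[OF c] by (auto intro!: open_Times)
  then have op': "open W'"
    unfolding W'_def by (intro continuous_open_preimage continuous_on_Pair cont W(1))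
  have "g2 (s0, u0) \<noteq> 0"
  proof
    \<comment> \<open>Components transform linearly, so a tangent vector that is \<open>0\<close> in one chart is \<open>0\<close>.\<close>
    assume "g2 (s0, u0) = 0"
    then have "velocity A {p..q} (H s0) u0 = tangent_of A c (H s0 u0) (0 *\<^sub>R 0)"
      using loc(1)[OF W(2) I(2) u0] by simp
    also have "\<dots> = (\<lambda>d. 0 *\<^sub>R tangent_of A c (H s0 u0) 0 d)"
      by (rule tangent_of_scaleR[OF c]) (use Hg[OF W(2) I(2) u0] in blast)
    finally show False using nz by simp
  qed
  then have in': "(s0, u0) \<in> W'"
    using W(2) Hg[OF W(2) I(2) u0] by (auto simp: W'_def)
  define D where "D = (\<lambda>z. frechet_derivative (local_F c) (at (g z, g2 z)) (g1 z, g12 z))"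
  have contD: "continuous_on W' D"
    unfolding D_def
    by (intro continuous_on_frechet_derivative[OF local_F_smooth[OF c]] continuous_on_Pair
        cont[THEN continuous_on_subset]) (auto simp: W'_def)
  have "((\<lambda>s. integrand (H s) p q u) has_real_derivative D (s, u)) (at s)"
    if su: "(s, u) \<in> W'" "s \<in> I" "u \<in> {p..q}" for s u
  proof -
    have suW: "(s, u) \<in> W" using su by (simp add: W'_def)
    have "((\<lambda>s. (g (s, u), g2 (s, u))) has_vector_derivative (g1 (s, u), g12 (s, u))) (at s)"
      unfolding g1_def g12_def
      by (intro has_vector_derivative_Pair smooth_on_partial_fst[OF g(1) suW] smooth_on_partial_fst[OF sm(2) suW])
    moreover have "(local_F c has_derivative frechet_derivative (local_F c) (at (g (s, u), g2 (s, u)))) (at (g (s, u), g2 (s, u)))"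
      by (rule smooth_on_has_derivative[OF local_F_smooth[OF c]]) (use su in \<open>auto simp: W'_def\<close>)
    ultimately have "((\<lambda>s. local_F c (g (s, u), g2 (s, u))) has_vector_derivative D (s, u)) (at s)"
      using vector_derivative_diff_chain_within[OF _ has_derivative_at_withinI,
          where f = "\<lambda>s. (g (s, u), g2 (s, u))" and g = "local_F c"]
      unfolding o_def D_def by blast
    then have "((\<lambda>s. local_F c (g (s, u), g2 (s, u))) has_real_derivative D (s, u)) (at s)"
      by (simp add: has_real_derivative_iff_has_vector_derivative)
    moreover have "open ((\<lambda>s. (s, u)) -` W' \<inter> I)"
      by (intro open_Int open_vimage op' I(1) continuous_intros)
    moreover have "s \<in> (\<lambda>s. (s, u)) -` W' \<inter> I" using su by simp
    moreover have "local_F c (g (s', u), g2 (s', u)) = integrand (H s') p q u"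
      if "s' \<in> (\<lambda>s. (s, u)) -` W' \<inter> I" for s'
      using loc(2)[of s' u] that su by (auto simp: W'_def)
    ultimately show ?thesis by (rule has_field_derivative_transform_within_open)
  qed
  with op' in' contD show ?thesis by (intro exI[of _ W'] exI[of _ D]) auto
qed

text \<open>
  By the tube lemma the velocities of all curves \<open>H s\<close> with \<open>s\<close> near \<open>s0\<close> have no zeros, so the
  integrand is continuously differentiable in \<open>s\<close> there, and one may differentiate under the integral.
\<close>

lemma len_variation_differentiable:
  fixes I :: "real set"
  assumes H: "smooth_into A (I \<times> {p..q}) (\<lambda>(s, u). H s u)" and I: "open I" "s0 \<in> I"
    and pq: "p < q" and nz: "\<And>u. u \<in> {p..q} \<Longrightarrow> velocity A {p..q} (H s0) u \<noteq> (\<lambda>_. 0)"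
  shows "\<exists>D. ((\<lambda>s. len A F (H s) p q) has_real_derivative D) (at s0)"
proof -
  define good where "good W D \<longleftrightarrow> open W \<and> continuous_on W D \<and>
    (\<forall>s u. (s, u) \<in> W \<inter> I \<times> {p..q} \<longrightarrow>
       ((\<lambda>s. integrand (H s) p q u) has_real_derivative D (s, u)) (at s))" for W D
  \<comment> \<open>Each good \<open>D\<close> agrees with \<open>?D\<close> below on the part of \<open>W\<close> over \<open>{p..q}\<close>, whence \<open>?D\<close> is continuous.\<close>
  define \<Omega> where "\<Omega> = \<Union>{W. \<exists>D. good W D}"
  have "open \<Omega>" unfolding \<Omega>_def by (rule open_Union) (auto simp: good_def)
  moreover have "{s0} \<times> {p..q} \<subseteq> \<Omega>"
    using integrand_variation_local[OF H I _ pq nz] unfolding \<Omega>_def good_def by blast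
  ultimately obtain X where X: "s0 \<in> X" "open X" "X \<times> {p..q} \<subseteq> \<Omega>"
    using Elementary_Topology.tube_lemma[of "{p..q}" \<Omega> s0] by auto
  have "open (X \<inter> I)" "s0 \<in> X \<inter> I" using X I by auto
  then obtain \<delta> where \<delta>: "\<delta> > 0" "ball s0 \<delta> \<subseteq> X \<inter> I" using open_contains_ball by blast
  let ?U = "ball s0 \<delta>"
  let ?f = "\<lambda>s. integrand (H s) p q"
  let ?D = "\<lambda>s u. deriv (\<lambda>s. ?f s u) s"
  have goodpt: "\<exists>W D. good W D \<and> (s, u) \<in> W" if "s \<in> ?U" "u \<in> {p..q}" for s u
  proof -
    have "(s, u) \<in> X \<times> {p..q}" using that \<delta>(2) by blast
    then have "(s, u) \<in> \<Omega>" using X(3) by blast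
    then show ?thesis unfolding \<Omega>_def by blast
  qed
  have deriv: "((\<lambda>s. ?f s u) has_real_derivative D (s, u)) (at s)" "?D s u = D (s, u)"
    if "good W D" "(s, u) \<in> W" "s \<in> ?U" "u \<in> {p..q}" for W D s u
  proof -
    show "((\<lambda>s. ?f s u) has_real_derivative D (s, u)) (at s)"
      using that \<delta> unfolding good_def by blast
    then show "?D s u = D (s, u)" by (rule DERIV_imp_deriv)
  qed
  have "((\<lambda>s. integral (cbox p q) (?f s)) has_field_derivative integral (cbox p q) (?D s0)) (at s0 within ?U)"
  proof (rule leibniz_rule_field_derivative)
    show "((\<lambda>s. ?f s u) has_real_derivative ?D s u) (at s within ?U)" if s: "s \<in> ?U" and "u \<in> cbox p q" for s u
    proof -
      have u: "u \<in> {p..q}" using that by simp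
      obtain W D where WD: "good W D" "(s, u) \<in> W" using goodpt[OF s u] by blast
      show ?thesis
        using deriv[OF WD s u] has_field_derivative_at_within by fastforce
    qed
    show "?f s integrable_on cbox p q" if "s \<in> ?U" for s
    proof -
      have "smooth_into A {p..q} (H s)" using smooth_into_slice[OF H] that \<delta> by auto
      then show ?thesis using smooth_into_has_integral pq by (auto simp: integrable_on_def)
    qed
    show "continuous_on (?U \<times> cbox p q) (\<lambda>(s, u). ?D s u)"
    proof (rule continuous_on_local)
      fix z assume z: "z \<in> ?U \<times> cbox p q"
      obtain s u where su: "z = (s, u)" "s \<in> ?U" "u \<in> {p..q}" using z by (cases z) auto
      obtain W D where WD: "good W D" "(s, u) \<in> W" using goodpt su by blast
      have "continuous_on (W \<inter> ?U \<times> cbox p q) D"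
        using WD(1) unfolding good_def by (blast intro: continuous_on_subset)
      then have "continuous_on (W \<inter> ?U \<times> cbox p q) (\<lambda>(s, u). ?D s u)"
        by (rule continuous_on_eq) (use deriv(2)[OF WD(1)] in auto)
      then show "\<exists>W. open W \<and> z \<in> W \<and> continuous_on (W \<inter> ?U \<times> cbox p q) (\<lambda>(s, u). ?D s u)"
        using WD su(1) unfolding good_def by blast
    qed
  qed (use \<delta> in auto)
  then have "((\<lambda>s. len A F (H s) p q) has_real_derivative integral {p..q} (?D s0)) (at s0)"
    using \<delta>(1) by (simp add: len_def at_within_open[of s0 ?U])
  then show ?thesis by blast
qed

lemma len_variation_subdivision:
  fixes I :: "real set"
  assumes t: "subdivision a b n t" "a < b" and s: "s \<in> I"
    and H: "\<And>i. i < n \<Longrightarrow> smooth_into A (I \<times> {t i..t (Suc i)}) (\<lambda>(s, u). H s u)"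
  shows "piecewise_smooth A (H s) a b"
    and "len A F (H s) a b = (\<Sum>i<n. len A F (H s) (t i) (t (Suc i)))"
proof -
  have sm: "smooth_into A {t i..t (Suc i)} (H s)" if "i < n" for i
    using smooth_into_slice[OF H[OF that] s] .
  then show "piecewise_smooth A (H s) a b"
    using t unfolding piecewise_smooth_def by blast
  have "0 < n" using t by (cases n) (auto simp: subdivision_def)
  from subdivision_has_integral[OF t(1) this sm]
  show "len A F (H s) a b = (\<Sum>i<n. len A F (H s) (t i) (t (Suc i)))"
    unfolding len_def[of A F "H s" a b] by (blast intro: integral_unique)
qed

text \<open>
  The length is the sum of the lengths of the pieces of the variation, for all \<open>s\<close> at once.
\<close>

lemma regular_variation_differentiable:
  assumes reg: "regular_curve A \<gamma> a b" and H: "variation A \<gamma> a b \<epsilon> H"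
  shows "\<exists>D. ((\<lambda>s. len A F (H s) a b) has_real_derivative D) (at 0)"
proof -
  let ?I = "{-\<epsilon><..<\<epsilon>}"
  obtain n t where t: "subdivision a b n t"
    and sm: "\<And>i. i < n \<Longrightarrow> smooth_into A (?I \<times> {t i..t (Suc i)}) (\<lambda>(s, u). H s u)"
    using H unfolding variation_def by blast
  have ab: "a < b" using reg by (simp add: regular_curve_def)
  have I: "open ?I" "0 \<in> ?I" using H by (auto simp: variation_def)
  have "\<exists>D. ((\<lambda>s. len A F (H s) (t i) (t (Suc i))) has_real_derivative D) (at 0)" if i: "i < n" for i
  proof (rule len_variation_differentiable[OF sm[OF i] I])
    show lt: "t i < t (Suc i)" using t i by (simp add: subdivision_def)
    have sub: "{t i..t (Suc i)} \<subseteq> {a..b}" by (rule subdivision_subset[OF t i])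
    have eq: "H 0 u = \<gamma> u" if "u \<in> {t i..t (Suc i)}" for u
      using H that sub unfolding variation_def by blast
    have "smooth_into A {t i..t (Suc i)} (H 0)" by (rule smooth_into_slice[OF sm[OF i] I(2)])
    then have sm\<gamma>: "smooth_into A {t i..t (Suc i)} \<gamma>" using smooth_into_cong[of _ "H 0" \<gamma>] eq by blast
    show "velocity A {t i..t (Suc i)} (H 0) u \<noteq> (\<lambda>_. 0)" if "u \<in> {t i..t (Suc i)}" for u
      using regular_curve_velocity_nonzero[OF reg sm\<gamma> sub that lt]
        velocity_cong[of "{t i..t (Suc i)}" "H 0" \<gamma> u A, OF eq that] by simp
  qed
  then obtain D where D: "\<And>i. i < n \<Longrightarrow>
      ((\<lambda>s. len A F (H s) (t i) (t (Suc i))) has_real_derivative D i) (at 0)" by metis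
  have "((\<lambda>s. \<Sum>i<n. len A F (H s) (t i) (t (Suc i))) has_real_derivative (\<Sum>i<n. D i)) (at 0)"
    by (rule DERIV_sum) (use D in auto)
  then have "((\<lambda>s. len A F (H s) a b) has_real_derivative (\<Sum>i<n. D i)) (at 0)"
    by (rule has_field_derivative_transform_within_open[OF _ I])
      (rule len_variation_subdivision(2)[OF t ab _ sm, symmetric])
  then show ?thesis by blast
qed

text \<open>
  Every member of a variation is a competitor for the infimum that defines the pre-distance, so
  that the length has a local minimum at \<open>s = 0\<close>.
\<close>

lemma minimizing_imp_pregeodesic:
  assumes \<gamma>: "piecewise_smooth A \<gamma> a b" and min: "dist_F (\<gamma> a) (\<gamma> b) = ereal (len A F \<gamma> a b)"
  shows "pregeodesic A F \<gamma> a b"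
proof -
  have crit: "D = 0" if H: "variation A \<gamma> a b \<epsilon> H"
    and D: "((\<lambda>s. len A F (H s) a b) has_real_derivative D) (at 0)" for \<epsilon> H D
  proof -
    obtain n t where t: "subdivision a b n t"
      and sm: "\<And>i. i < n \<Longrightarrow> smooth_into A ({-\<epsilon><..<\<epsilon>} \<times> {t i..t (Suc i)}) (\<lambda>(s, u). H s u)"
      and \<epsilon>: "0 < \<epsilon>" and H0: "\<And>u. u \<in> {a..b} \<Longrightarrow> H 0 u = \<gamma> u"
      and ends: "\<And>s. s \<in> {-\<epsilon><..<\<epsilon>} \<Longrightarrow> H s a = \<gamma> a \<and> H s b = \<gamma> b"
      using H unfolding variation_def by blast
    have ab: "a < b" using \<gamma> by (simp add: piecewise_smooth_def)
    have "len A F (H 0) a b \<le> len A F (H s) a b" if "\<bar>0 - s\<bar> < \<epsilon>" for s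
    proof -
      have s: "s \<in> {-\<epsilon><..<\<epsilon>}" using that by auto
      have "ereal (len A F \<gamma> a b) \<le> ereal (len A F (H s) a b)"
        using pre_dist_le_len[OF len_variation_subdivision(1)[OF t ab s sm]] ends[OF s] min by simp
      then show ?thesis using len_cong[of a b "H 0" \<gamma>, OF H0] by simp
    qed
    then show "D = 0" using DERIV_local_min[OF D \<epsilon>] by blast
  qed
  show ?thesis
    unfolding pregeodesic_def
  proof (intro conjI allI impI \<gamma>)
    fix \<epsilon> H assume H: "variation A \<gamma> a b \<epsilon> H"
    show "((\<lambda>s. len A F (H s) a b) has_real_derivative 0) (at 0)" if "regular_curve A \<gamma> a b"
      using regular_variation_differentiable[OF that H] crit[OF H] by blast
    show "D = 0" if "((\<lambda>s. len A F (H s) a b) has_real_derivative D) (at 0)" for D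
      using crit[OF H that] .
  qed
qed

end

theorem proposition2p4:
  fixes T :: "'a topology"
    and A :: "('a, 'e::euclidean_space) chart set"
    and F :: "'a \<Rightarrow> ('a, 'e) tvec \<Rightarrow> real"
  assumes "smooth_manifold T A" and "connected_space T" and "pre_finsler A F"
  defines "S \<equiv> topspace T" and "d \<equiv> pre_dist A F"
  shows "(\<forall>x\<in>S. \<forall>y\<in>S. d x y \<noteq> \<infinity>) \<and>
    (\<forall>x\<in>S. \<forall>y\<in>S. \<forall>z\<in>S. d x z \<le> d x y + d y z) \<and>
    (\<forall>\<gamma> a b. piecewise_smooth A \<gamma> a b \<and> d (\<gamma> a) (\<gamma> b) = ereal (len A F \<gamma> a b) \<longrightarrow>
       pregeodesic A F \<gamma> a b) \<and>
    ((\<exists>x\<in>S. d x x < 0) \<longrightarrow> (\<forall>x\<in>S. \<forall>y\<in>S. d x y = -\<infinity>)) \<and>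
    ((\<exists>x\<in>S. \<exists>y\<in>S. d x y = -\<infinity>) \<longrightarrow> (\<forall>x\<in>S. \<forall>y\<in>S. d x y = -\<infinity>)) \<and>
    (\<not> (\<forall>x\<in>S. \<forall>y\<in>S. d x y = -\<infinity>) \<longrightarrow>
       (\<forall>x\<in>S. \<forall>y\<in>S. \<bar>d x y\<bar> \<noteq> \<infinity>) \<and>
       continuous_map (prod_topology T T) euclideanreal (\<lambda>(x, y). real_of_ereal (d x y)))"
proof -
  interpret pre_finsler_manifold T A F
    by unfold_locales (fact assms)+
  have not_inf: "\<forall>x\<in>S. \<forall>y\<in>S. d x y \<noteq> \<infinity>"
    unfolding S_def d_def using pre_dist_not_infinity[OF assms(2)] by blast
  have all_minf: "\<forall>x\<in>S. \<forall>y\<in>S. d x y = -\<infinity>" if "\<exists>x\<in>S. \<exists>y\<in>S. d x y = -\<infinity>"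
    using that pre_dist_minus_infinity_everywhere[OF assms(2)] unfolding S_def d_def by blast
  have neg: "\<forall>x\<in>S. \<forall>y\<in>S. d x y = -\<infinity>" if "\<exists>x\<in>S. d x x < 0"
    using that pre_dist_self_negative all_minf unfolding d_def by blast
  have cont: "(\<forall>x\<in>S. \<forall>y\<in>S. \<bar>d x y\<bar> \<noteq> \<infinity>) \<and>
      continuous_map (prod_topology T T) euclideanreal (\<lambda>(x, y). real_of_ereal (d x y))"
    if "\<not> (\<forall>x\<in>S. \<forall>y\<in>S. d x y = -\<infinity>)"
  proof -
    have "\<forall>x\<in>S. \<forall>y\<in>S. \<bar>d x y\<bar> \<noteq> \<infinity>"
      using that all_minf not_inf by (metis abs_neq_infinity_cases ereal_infinity_cases)
    moreover from this
    have "continuous_map (prod_topology T T) euclideanreal (\<lambda>(x, y). real_of_ereal (d x y))"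
      unfolding S_def d_def by (intro pre_dist_continuous) simp
    ultimately show ?thesis by blast
  qed
  show ?thesis
  proof (intro conjI)
    show "\<forall>x\<in>S. \<forall>y\<in>S. \<forall>z\<in>S. d x z \<le> d x y + d y z"
      unfolding d_def using pre_dist_triangle by blast
    show "\<forall>\<gamma> a b. piecewise_smooth A \<gamma> a b \<and> d (\<gamma> a) (\<gamma> b) = ereal (len A F \<gamma> a b) \<longrightarrow>
       pregeodesic A F \<gamma> a b"
      unfolding d_def using minimizing_imp_pregeodesic by blast
  qed (use not_inf all_minf neg cont in blast)+
qed

end
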